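(* Let $m\in C_{1-\xi;\Psi}(J,\mathbb{R})$. Let $t_1\in(0,T]$ be such that $m(t_1)=0$ and $m(t)\le0$ for all $t\in(0,t_1)$. Then ${}^H\mathcal{D}^{\mu,\nu;\Psi}_{0^+}m(t_1)\ge0$.
   Context: Fix $T>0$, $J=[0,T]$, $0<\mu<1$, $0\le\nu\le1$, $\xi=\mu+\nu(1-\mu)$, and an increasing function $\Psi\in C^1(J,\mathbb{R})$ with $\Psi'(t)\ne0$ for all $t\in J$. $C_{1-\xi;\Psi}(J,\mathbb{R})$ is the set of functions $h:(0,T]\to\mathbb{R}$ such that $t\mapsto(\Psi(t)-\Psi(0))^{1-\xi}h(t)$ is (extends to) a continuous function on $J$. For $\alpha>0$, $I_{0^+}^{\alpha;\Psi}h(t)=\frac{1}{\Gamma(\alpha)}\int_0^t\Psi'(s)(\Psi(t)-\Psi(s))^{\alpha-1}h(s)\,ds$, and $I_{0^+}^{0;\Psi}$ is the identity. The $\Psi$-Hilfer derivative of order $\mu$ and type $\nu$ is ${}^H\mathcal{D}^{\mu,\nu;\Psi}_{0^+}h(t)=I_{0^+}^{\nu(1-\mu);\Psi}\left(\frac{1}{\Psi'(t)}\frac{d}{dt}\right)I_{0^+}^{(1-\nu)(1-\mu);\Psi}h(t)$. *)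

theory Defs
  imports "HOL-Analysis.Analysis"
begin

text \<open>
  Functions on \<open>J = [0,T]\<close> or on \<open>(0,T]\<close> are total functions on the reals whose values outside
  that set are never used.  Derivatives are taken within \<open>J\<close>, so they are one-sided at the end
  points of \<open>J\<close> and two-sided in its interior.
\<close>

definition deriv_on_J :: "real \<Rightarrow> (real \<Rightarrow> real) \<Rightarrow> real \<Rightarrow> real" where
  "deriv_on_J T f t = vector_derivative f (at t within {0..T})"

text \<open>Unlike \<^const>\<open>C1_differentiable_on\<close>, this does not constrain the function outside \<open>J\<close>.\<close>

definition C1_on_J :: "real \<Rightarrow> (real \<Rightarrow> real) \<Rightarrow> bool" where
  "C1_on_J T f \<longleftrightarrow>
     (\<forall>t\<in>{0..T}. f differentiable (at t within {0..T})) \<and> continuous_on {0..T} (deriv_on_J T f)"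

definition weighted_C :: "real \<Rightarrow> (real \<Rightarrow> real) \<Rightarrow> real \<Rightarrow> (real \<Rightarrow> real) set" where
  "weighted_C T \<Psi> \<rho> =
     {h. \<exists>g. continuous_on {0..T} g \<and> (\<forall>t\<in>{0<..T}. g t = (\<Psi> t - \<Psi> 0) powr \<rho> * h t)}"

definition frac_integrand ::
    "real \<Rightarrow> (real \<Rightarrow> real) \<Rightarrow> real \<Rightarrow> (real \<Rightarrow> real) \<Rightarrow> real \<Rightarrow> real \<Rightarrow> real" where
  "frac_integrand T \<Psi> \<alpha> h t s = deriv_on_J T \<Psi> s * (\<Psi> t - \<Psi> s) powr (\<alpha> - 1) * h s"

definition frac_integral ::
    "real \<Rightarrow> (real \<Rightarrow> real) \<Rightarrow> real \<Rightarrow> (real \<Rightarrow> real) \<Rightarrow> real \<Rightarrow> real" where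
  "frac_integral T \<Psi> \<alpha> h t =
     (if \<alpha> = 0 then h t
      else 1 / Gamma \<alpha> * (LINT s:{0<..<t}|lborel. frac_integrand T \<Psi> \<alpha> h t s))"

definition frac_integral_exists ::
    "real \<Rightarrow> (real \<Rightarrow> real) \<Rightarrow> real \<Rightarrow> (real \<Rightarrow> real) \<Rightarrow> real \<Rightarrow> bool" where
  "frac_integral_exists T \<Psi> \<alpha> h t \<longleftrightarrow>
     \<alpha> = 0 \<or> set_integrable lborel {0<..<t} (frac_integrand T \<Psi> \<alpha> h t)"

definition psi_deriv :: "real \<Rightarrow> (real \<Rightarrow> real) \<Rightarrow> (real \<Rightarrow> real) \<Rightarrow> real \<Rightarrow> real" where
  "psi_deriv T \<Psi> f t = 1 / deriv_on_J T \<Psi> t * deriv_on_J T f t"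

definition hilfer_deriv ::
    "real \<Rightarrow> (real \<Rightarrow> real) \<Rightarrow> real \<Rightarrow> real \<Rightarrow> (real \<Rightarrow> real) \<Rightarrow> real \<Rightarrow> real" where
  "hilfer_deriv T \<Psi> \<mu> \<nu> h =
     frac_integral T \<Psi> (\<nu> * (1 - \<mu>))
       (psi_deriv T \<Psi> (frac_integral T \<Psi> ((1 - \<nu>) * (1 - \<mu>)) h))"

text \<open>
  The operators above are total, with meaningless values where an integral diverges or a derivative
  does not exist.  The next predicate says that the expression defining the Hilfer derivative at
  \<open>t\<close> is meaningful: the inner integrals converge, the inner function is differentiable at every
  point where the outer operator evaluates its derivative (only \<open>t\<close> itself if the outer operator
  is the identity, the whole of \<open>(0,t)\<close> otherwise), and the outer integral converges.
\<close>

definition hilfer_deriv_exists ::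
    "real \<Rightarrow> (real \<Rightarrow> real) \<Rightarrow> real \<Rightarrow> real \<Rightarrow> (real \<Rightarrow> real) \<Rightarrow> real \<Rightarrow> bool" where
  "hilfer_deriv_exists T \<Psi> \<mu> \<nu> h t \<longleftrightarrow>
     (\<forall>r\<in>{0<..T}. frac_integral_exists T \<Psi> ((1 - \<nu>) * (1 - \<mu>)) h r) \<and>
     (\<forall>s\<in>(if \<nu> * (1 - \<mu>) = 0 then {t} else {0<..<t}).
        frac_integral T \<Psi> ((1 - \<nu>) * (1 - \<mu>)) h differentiable (at s within {0..T})) \<and>
     frac_integral_exists T \<Psi> (\<nu> * (1 - \<mu>))
       (psi_deriv T \<Psi> (frac_integral T \<Psi> ((1 - \<nu>) * (1 - \<mu>)) h)) t"

end

theory Submission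
  imports Defs
begin

text \<open>
  Put \<open>q = \<Psi> t1 - \<Psi>\<close>, \<open>\<beta> = (1 - \<nu>) (1 - \<mu>)\<close>, \<open>n = - m \<ge> 0\<close> and let \<open>G\<close> be \<open>\<Gamma>(\<beta>)\<close> times the fractional integral
  of \<open>n\<close> of order \<open>\<beta>\<close>.  A Tonelli computation turns
  \<open>W a = q(a)\<^sup>-\<^sup>\<beta> G(a) - \<beta> \<integral>\<^sub>0\<^sup>a \<Psi>' q\<^sup>-\<^sup>1\<^sup>-\<^sup>\<beta> G\<close> into an integral of \<open>n\<close> against a positive kernel, so
  that \<open>W \<ge> 0\<close>; since \<open>m\<close> vanishes at \<open>t1\<close>, moreover \<open>W \<rightarrow> 0\<close> at \<open>t1\<close>.  As \<open>W' = q\<^sup>-\<^sup>\<beta> G'\<close>, the Hilfer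
  derivative is a negative multiple of \<open>\<integral> q\<^sup>-\<^sup>\<mu> W'\<close>, which is \<open>\<le> 0\<close> because \<open>(q\<^sup>-\<^sup>\<mu> W)' \<ge> q\<^sup>-\<^sup>\<mu> W'\<close> and
  \<open>q\<^sup>-\<^sup>\<mu> W\<close> is bounded near \<open>t1\<close> by the tail of \<open>\<integral> q\<^sup>-\<^sup>\<mu> \<bar>W'\<bar>\<close>.  For \<open>\<nu> = 0\<close> there is no outer integral;
  there \<open>G'(t1) > 0\<close> would force \<open>W < 0\<close> just before \<open>t1\<close>.  For \<open>\<nu> = 1\<close> take \<open>W = n\<close>.
\<close>

section \<open>Identities and inequalities for real powers\<close>

text \<open>The chain rule for the \<open>\<beta>\<close>-th power of a quotient with denominator
  \<open>Z\<close> produces the left side, where \<open>x\<close> over the square of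
  \<open>Z\<close> is the derivative of the quotient. The right side is the form in which the
  kernels below are written.\<close>

lemma powr_quotient_mult:
  fixes Y Z \<beta> x :: real
  assumes "0 < Y" "0 < Z"
  shows "(Y / Z) powr (\<beta> - 1) * (x / Z\<^sup>2) = x * (Z powr (- 1 - \<beta>) * Y powr (\<beta> - 1))"
proof -
  have "Z powr (1 - \<beta>) = 1 / Z powr (\<beta> - 1)" using powr_minus_divide[of Z "\<beta> - 1"] by simp
  moreover have "Z powr (- 2) = 1 / Z\<^sup>2" using assms by (simp add: powr_minus_divide)
  moreover have "Z powr (- 1 - \<beta>) = Z powr (1 - \<beta>) * Z powr (- 2)"
    by (simp add: powr_add[symmetric])
  ultimately show ?thesis using assms by (simp add: powr_divide)
qed

text \<open>With \<open>Z = D + Y\<close> the fractions \<open>D / Z\<close> and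
  \<open>Y / Z\<close> add up to 1, and each grows when its exponent drops from 1 to
  \<open>\<beta>\<close> or \<open>1 - \<beta>\<close>. Multiplying by the left side gives a sum of
  two terms, each with an elementary primitive once \<open>D\<close> and \<open>Y\<close> become
  differences of \<open>P\<close>.\<close>

lemma majorant_inequality:
  fixes D Y \<beta> :: real
  assumes "0 < D" "0 < Y" "0 < \<beta>" "\<beta> < 1"
  shows "D powr (1 - \<beta>) * Y powr (\<beta> - 1) / (D + Y)
    \<le> D * Y powr (\<beta> - 1) * (D + Y) powr (- 1 - \<beta>) + D powr (1 - \<beta>) * (D + Y) powr (\<beta> - 2)"
proof -
  define Z where "Z = D + Y"
  define c where "c = D powr (1 - \<beta>) * Y powr (\<beta> - 1) / Z"
  have Z: "0 < Z" "D \<le> Z" "Y \<le> Z" using assms by (auto simp: Z_def)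
  have "1 = D / Z + Y / Z" using Z by (simp add: Z_def add_divide_distrib[symmetric])
  also have "\<dots> \<le> (D / Z) powr \<beta> + (Y / Z) powr (1 - \<beta>)"
    using powr_mono'[of \<beta> 1 "D / Z"] powr_mono'[of "1 - \<beta>" 1 "Y / Z"] assms Z by auto
  finally have "c * 1 \<le> c * ((D / Z) powr \<beta> + (Y / Z) powr (1 - \<beta>))"
    using Z by (intro mult_left_mono) (auto simp: c_def)
  also have "\<dots> = c * (D / Z) powr \<beta> + c * (Y / Z) powr (1 - \<beta>)" by (simp add: distrib_left)
  also have "c * (D / Z) powr \<beta> = (D powr (1 - \<beta>) * D powr \<beta>) * Y powr (\<beta> - 1) * (Z powr (- 1) * Z powr (- \<beta>))"
    using Z assms by (simp add: c_def powr_divide powr_minus divide_simps)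
  also have "\<dots> = D * Y powr (\<beta> - 1) * Z powr (- 1 - \<beta>)"
  proof -
    have "Z powr (- 1) * Z powr (- \<beta>) = Z powr (- 1 - \<beta>)"
      using powr_add[of Z "- 1" "- \<beta>"] by simp
    moreover have "D powr (1 - \<beta>) * D powr \<beta> = D"
      using assms by (simp add: powr_add[symmetric])
    ultimately show ?thesis by (simp only:)
  qed
  also have "c * (Y / Z) powr (1 - \<beta>) =
      D powr (1 - \<beta>) * (Y powr (\<beta> - 1) * Y powr (1 - \<beta>)) * (Z powr (- 1) * Z powr (- (1 - \<beta>)))"
    using Z assms by (simp add: c_def powr_divide powr_minus_divide[of Z 1] powr_minus_divide[of Z "1 - \<beta>"] del: minus_diff_eq)
  also have "\<dots> = D powr (1 - \<beta>) * Z powr (\<beta> - 2)"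
  proof -
    have "Z powr (- 1) * Z powr (- (1 - \<beta>)) = Z powr (\<beta> - 2)"
      using powr_add[of Z "- 1" "- (1 - \<beta>)"] by simp
    moreover have "Y powr (\<beta> - 1) * Y powr (1 - \<beta>) = 1"
      using assms by (simp add: powr_add[symmetric])
    ultimately show ?thesis by (simp only: mult_1_right)
  qed
  finally show ?thesis by (simp add: c_def Z_def)
qed

section \<open>Calculus along an increasing clock\<close>

text \<open>Here \<open>b\<close> stands for \<open>t1\<close>, \<open>P\<close> for
  \<open>\<Psi>\<close> and \<open>p\<close> for its derivative. Measurability is asked on the whole
  line so that Tonelli's theorem applies to kernels built from \<open>P\<close> and
  \<open>p\<close>.\<close>

locale clock =
  fixes b :: real and P p :: "real \<Rightarrow> real"
  assumes b_pos: "0 < b"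
    and P_deriv: "\<And>x. x \<in> {0..b} \<Longrightarrow> (P has_real_derivative p x) (at x within {0..b})"
    and p_pos: "\<And>x. x \<in> {0..b} \<Longrightarrow> 0 < p x"
    and p_cont: "continuous_on {0..b} p"
    and P_meas [measurable]: "P \<in> borel_measurable borel"
    and p_meas [measurable]: "p \<in> borel_measurable borel"
begin

lemma P_cont: "continuous_on {0..b} P"
  using P_deriv DERIV_continuous_on by blast

lemma P_DERIV: "0 < x \<Longrightarrow> x < b \<Longrightarrow> (P has_real_derivative p x) (at x)"
  using P_deriv[of x] by (simp add: at_within_Icc_at)

lemma P_less: "P x < P y" if "0 \<le> x" "x < y" "y \<le> b" for x y
proof (rule DERIV_pos_imp_increasing_open[OF \<open>x < y\<close>])
  show "\<exists>d. (P has_real_derivative d) (at z) \<and> 0 < d" if "x < z" "z < y" for z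
    using P_DERIV[of z] p_pos[of z] \<open>0 \<le> x\<close> \<open>y \<le> b\<close> that by auto
  show "continuous_on {x..y} P"
    using P_cont by (rule continuous_on_subset) (use that in auto)
qed

lemma P_le: "P x \<le> P y" if "0 \<le> x" "x \<le> y" "y \<le> b" for x y
  using P_less[of x y] that by (cases "x = y") auto

lemma P_isCont: "0 < x \<Longrightarrow> x < b \<Longrightarrow> isCont P x"
  using P_DERIV DERIV_isCont by blast

lemma DERIV_powr_P_diff:
  assumes "0 < x" "x < b"
  shows "((\<lambda>u. (P b - P u) powr (- \<rho>)) has_real_derivative \<rho> * (p x * (P b - P x) powr (- 1 - \<rho>))) (at x)"
proof -
  have "((\<lambda>u. P b - P u) has_real_derivative - p x) (at x)"
    using P_DERIV[of x] assms by (auto intro!: derivative_eq_intros)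
  moreover have "0 < P b - P x" using P_less assms by simp
  moreover have "- \<rho> - of_nat 1 = - 1 - \<rho>" by simp
  ultimately show ?thesis using DERIV_fun_powr[of "\<lambda>u. P b - P u" "- p x" x "- \<rho>"]
    by (simp only: mult_minus_left mult_minus_right minus_minus mult_ac)
qed

section \<open>Two explicit kernel integrals\<close>

text \<open>Substituting \<open>u = (P s - P r) / (P b - P s)\<close> turns the integrand into
  \<open>u powr (\<beta> - 1) / (P b - P r)\<close>, so \<open>F\<close> below is a primitive. This
  is the inner integral after the exchange of order in \<open>nn_integral_G\<close>.\<close>

lemma kernel_convolution:
  fixes \<beta> r a :: real
  assumes "0 < \<beta>" "0 < r" "r < a" "a < b"
  shows "(\<integral>\<^sup>+ s. ennreal (indicator {r<..<a} s *
            (p s * (P b - P s) powr (- 1 - \<beta>) * (P s - P r) powr (\<beta> - 1))) \<partial>lborel)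
       = ennreal ((P a - P r) powr \<beta> * (P b - P a) powr (- \<beta>) / (\<beta> * (P b - P r)))"
proof -
  define F where "F s = ((P s - P r) / (P b - P s)) powr \<beta> / (\<beta> * (P b - P r))" for s
  have "((\<lambda>s. p s * (P b - P s) powr (- 1 - \<beta>) * (P s - P r) powr (\<beta> - 1))
          has_integral (F a - F r)) {r..a}"
  \<comment> \<open>The integrand is singular at \<open>s = r\<close> when
    \<open>\<beta> < 1\<close>; continuity of \<open>F\<close> up to the end points suffices
    there.\<close>
  proof (rule fundamental_theorem_of_calculus_interior)
    have c: "continuous_on {r..a} P"
      using P_cont by (rule continuous_on_subset) (use assms in auto)
    show "continuous_on {r..a} F"
      unfolding F_def
    proof -
      have nz: "P b - P x > 0" if "x \<in> {r..a}" for x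
        using P_less[of x b] assms that by auto
      have nz2: "P x - P r \<ge> 0" if "x \<in> {r..a}" for x
        using P_le[of r x] assms that by auto
      have nz3: "P b - P r > 0" using P_less[of r b] assms by auto
      show "continuous_on {r..a} (\<lambda>s. ((P s - P r) / (P b - P s)) powr \<beta> / (\<beta> * (P b - P r)))"
      proof (intro continuous_on_divide continuous_on_powr' continuous_on_diff continuous_on_const c ballI)
        show "0 \<le> (P x - P r) / (P b - P x) \<and> ((P x - P r) / (P b - P x) = 0 \<longrightarrow> 0 < \<beta>)"
          if "x \<in> {r..a}" for x
          using nz[OF that] nz2[OF that] assms(1) by auto
        show "P b - P x \<noteq> 0" if "x \<in> {r..a}" for x using nz[OF that] by simp
        show "\<beta> * (P b - P r) \<noteq> 0" using nz3 assms(1) by simp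
      qed
    qed
    fix s assume s: "s \<in> {r<..<a}"
    have 1: "P r < P s" "P s < P b" using P_less s assms by auto
    have d: "(P has_real_derivative p s) (at s)" using P_DERIV s assms by auto
    have "(F has_real_derivative
       (((P s - P r) / (P b - P s)) powr (\<beta> - 1) * (p s * (P b - P r) / (P b - P s)^2)) / (P b - P r)) (at s)"
    proof -
      have "((\<lambda>s. (P s - P r) / (P b - P s)) has_real_derivative p s * (P b - P r) / (P b - P s)^2) (at s)"
        using 1 by (auto intro!: derivative_eq_intros d simp: power2_eq_square algebra_simps)
      from DERIV_cdivide[OF DERIV_fun_powr[OF this, of \<beta>], of "\<beta> * (P b - P r)"]
      show ?thesis unfolding F_def using 1 assms by simp
    qed
    also have "(((P s - P r) / (P b - P s)) powr (\<beta> - 1) * (p s * (P b - P r) / (P b - P s)^2)) / (P b - P r)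
       = p s * (P b - P s) powr (- 1 - \<beta>) * (P s - P r) powr (\<beta> - 1)"
      using powr_quotient_mult[of "P s - P r" "P b - P s" \<beta> "p s * (P b - P r)"] 1 by simp
    finally show "(F has_vector_derivative
        p s * (P b - P s) powr (- 1 - \<beta>) * (P s - P r) powr (\<beta> - 1)) (at s)"
      by (simp add: has_real_derivative_iff_has_vector_derivative)
  qed (use assms in auto)
  then have "((\<lambda>s. p s * (P b - P s) powr (- 1 - \<beta>) * (P s - P r) powr (\<beta> - 1))
          has_integral (F a - F r)) {r<..<a}"
    by (simp add: has_integral_Icc_iff_Ioo)
  then have "(\<integral>\<^sup>+ s. ennreal (indicator {r<..<a} s *
            (p s * (P b - P s) powr (- 1 - \<beta>) * (P s - P r) powr (\<beta> - 1))) \<partial>lborel) = ennreal (F a - F r)"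
    using p_pos assms
    by (intro nn_integral_has_integral_lebesgue mult_nonneg_nonneg) (auto intro!: less_imp_le)
  also have "F a - F r = (P a - P r) powr \<beta> * (P b - P a) powr (- \<beta>) / (\<beta> * (P b - P r))"
    using P_less[of r a] P_less[of a b] assms by (simp add: F_def powr_divide powr_minus divide_simps)
  finally show ?thesis .
qed

text \<open>The point is that the bound depends neither on \<open>c\<close> nor on \<open>a\<close>:
  in \<open>W_bound\<close> it multiplies a small number while \<open>a\<close> tends to
  \<open>b\<close>.\<close>

lemma majorant_integral:
  fixes \<beta> c a :: real
  assumes "0 < \<beta>" "\<beta> < 1" "0 < c" "c < a" "a < b"
  defines "k \<equiv> \<lambda>r. p r * ((P b - P a) * (P a - P r) powr (\<beta> - 1) * (P b - P r) powr (- 1 - \<beta>)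
            + (P b - P a) powr (1 - \<beta>) * (P b - P r) powr (\<beta> - 2))"
  shows "(\<integral>\<^sup>+ r. ennreal (indicator {c<..<a} r * k r) \<partial>lborel) \<le> ennreal (1 / \<beta> + 1 / (1 - \<beta>))"
proof -
  \<comment> \<open>\<open>k\<close> is the right-hand side of \<open>majorant_inequality\<close> times \<open>p\<close>, chosen for this bounded primitive.\<close>
  define U where "U r = - (((P a - P r) / (P b - P r)) powr \<beta> / \<beta>)
      + ((P b - P a) / (P b - P r)) powr (1 - \<beta>) / (1 - \<beta>)" for r
  have ab: "P a < P b" using P_less assms by auto
  have "(k has_integral (U a - U c)) {c..a}"
  proof (rule fundamental_theorem_of_calculus_interior)
    have c: "continuous_on {c..a} P"
      using P_cont by (rule continuous_on_subset) (use assms in auto)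
    have nz: "P b - P x > 0" if "x \<in> {c..a}" for x
      using P_less[of x b] assms that by auto
    have nz2: "P a - P x \<ge> 0" if "x \<in> {c..a}" for x
      using P_le[of x a] assms that by auto
    show "continuous_on {c..a} U"
      unfolding U_def
    proof (intro continuous_on_add continuous_on_minus continuous_on_divide continuous_on_powr'
        continuous_on_diff continuous_on_const c ballI)
      show "0 \<le> (P a - P x) / (P b - P x) \<and> ((P a - P x) / (P b - P x) = 0 \<longrightarrow> 0 < \<beta>)"
        "0 \<le> (P b - P a) / (P b - P x) \<and> ((P b - P a) / (P b - P x) = 0 \<longrightarrow> 0 < 1 - \<beta>)"
        "P b - P x \<noteq> 0" if "x \<in> {c..a}" for x
        using nz[OF that] nz2[OF that] assms(1,2) ab by auto
    qed (use assms(1,2) nz in force)+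
    fix s assume s: "s \<in> {c<..<a}"
    have 1: "P s < P a" "P s < P b" using P_less s assms by auto
    have d: "(P has_real_derivative p s) (at s)" using P_DERIV s assms by auto
    have "(U has_real_derivative
       ((P a - P s) / (P b - P s)) powr (\<beta> - 1) * (p s * (P b - P a) / (P b - P s)^2)
       + ((P b - P a) / (P b - P s)) powr (- \<beta>) * (p s * (P b - P a) / (P b - P s)^2)) (at s)"
    proof -
      have "((\<lambda>s. (P a - P s) / (P b - P s)) has_real_derivative - (p s * (P b - P a) / (P b - P s)^2)) (at s)"
        using 1 by (auto intro!: derivative_eq_intros d simp: power2_eq_square divide_simps) (simp add: algebra_simps)
      from DERIV_cdivide[OF DERIV_fun_powr[OF this, of \<beta>], of "\<beta>"]
      have 2: "((\<lambda>s. ((P a - P s) / (P b - P s)) powr \<beta> / \<beta>) has_real_derivative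
         - (((P a - P s) / (P b - P s)) powr (\<beta> - 1) * (p s * (P b - P a) / (P b - P s)^2))) (at s)"
        using 1 assms(1) by simp
      have "((\<lambda>s. (P b - P a) / (P b - P s)) has_real_derivative p s * (P b - P a) / (P b - P s)^2) (at s)"
        using 1 by (auto intro!: derivative_eq_intros d simp: power2_eq_square)
      from DERIV_cdivide[OF DERIV_fun_powr[OF this, of "1 - \<beta>"], of "1 - \<beta>"]
      have 3: "((\<lambda>s. ((P b - P a) / (P b - P s)) powr (1 - \<beta>) / (1 - \<beta>)) has_real_derivative
         ((P b - P a) / (P b - P s)) powr (- \<beta>) * (p s * (P b - P a) / (P b - P s)^2)) (at s)"
        using 1 assms(2) ab by simp
      show ?thesis unfolding U_def using DERIV_add[OF DERIV_minus[OF 2] 3] by simp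
    qed
    also have "((P a - P s) / (P b - P s)) powr (\<beta> - 1) * (p s * (P b - P a) / (P b - P s)^2)
       + ((P b - P a) / (P b - P s)) powr (- \<beta>) * (p s * (P b - P a) / (P b - P s)^2) = k s"
    proof -
      have "(P b - P a) powr (1 - \<beta>) = (P b - P a) powr (- \<beta>) * (P b - P a)"
        using ab by (metis diff_gt_0_iff_gt less_imp_le powr_add powr_one uminus_add_conv_diff)
      then have e: "(P b - P a) powr (1 - \<beta>) * (P b - P s) powr (\<beta> - 2)
          = (P b - P a) * ((P b - P s) powr (\<beta> - 2) * (P b - P a) powr (- \<beta>))"
        by (simp only: mult_ac)
      have "((P b - P a) / (P b - P s)) powr (- \<beta>) * (p s * (P b - P a) / (P b - P s)\<^sup>2)
          = p s * (P b - P a) * ((P b - P s) powr (\<beta> - 2) * (P b - P a) powr (- \<beta>))"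
        using powr_quotient_mult[of "P b - P a" "P b - P s" "1 - \<beta>" "p s * (P b - P a)"] 1 ab by simp
      moreover have "((P a - P s) / (P b - P s)) powr (\<beta> - 1) * (p s * (P b - P a) / (P b - P s)\<^sup>2)
          = p s * (P b - P a) * ((P b - P s) powr (- 1 - \<beta>) * (P a - P s) powr (\<beta> - 1))"
        using powr_quotient_mult[of "P a - P s" "P b - P s" \<beta> "p s * (P b - P a)"] 1 ab by simp
      ultimately show ?thesis
        unfolding k_def e by (simp only: distrib_left mult_ac)
    qed
    finally show "(U has_vector_derivative k s) (at s)"
      by (simp add: has_real_derivative_iff_has_vector_derivative)
  qed (use assms in auto)
  then have "(k has_integral (U a - U c)) {c<..<a}"
    by (simp add: has_integral_Icc_iff_Ioo)
  moreover have "0 \<le> k r" if "r \<in> {c<..<a}" for r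
    using p_pos[of r] that assms ab unfolding k_def by (intro mult_nonneg_nonneg add_nonneg_nonneg) auto
  ultimately have "(\<integral>\<^sup>+ r. ennreal (indicator {c<..<a} r * k r) \<partial>lborel) = ennreal (U a - U c)"
    by (intro nn_integral_has_integral_lebesgue)
  \<comment> \<open>At \<open>a\<close> the first term of \<open>U\<close> vanishes and the second
    is \<open>1 / (1 - \<beta>)\<close>. At \<open>c\<close> the first quotient is at most 1, and
    the second term only lowers the difference.\<close>
  also have "U a - U c \<le> 1 / \<beta> + 1 / (1 - \<beta>)"
  proof -
    have 1: "P c < P a" "P c < P b" using P_less assms by auto
    have "((P a - P c) / (P b - P c)) powr \<beta> \<le> 1 powr \<beta>"
      using 1 ab assms by (intro powr_mono2) auto
    then have "((P a - P c) / (P b - P c)) powr \<beta> / \<beta> \<le> 1 / \<beta>"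
      using assms(1) by (intro divide_right_mono) auto
    moreover have "0 \<le> ((P b - P a) / (P b - P c)) powr (1 - \<beta>) / (1 - \<beta>)"
      using assms by auto
    moreover have "U a = 1 / (1 - \<beta>)" using ab by (simp add: U_def)
    ultimately show ?thesis unfolding U_def[of c] by linarith
  qed
  finally show ?thesis by (simp add: ennreal_leI)
qed

section \<open>Sign of the outer integral\<close>

text \<open>No rate for the decay of \<open>W\<close> at \<open>b\<close> is assumed, although its
  weight may blow up there. Absolute integrability of the integrand supplies the rate: the boundary
  term at \<open>a\<close> is at most the tail \<open>J b - J a\<close>.\<close>

lemma outer_integral_nonpos:
  fixes \<mu> :: real and W W' :: "real \<Rightarrow> real"
  assumes mu: "0 \<le> \<mu>"
    and W_deriv: "\<And>x. x \<in> {0<..<b} \<Longrightarrow> (W has_real_derivative W' x) (at x)"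
    and W_nonneg: "\<And>x. x \<in> {0<..<b} \<Longrightarrow> 0 \<le> W x"
    and W_lim: "(W \<longlongrightarrow> 0) (at_left b)"
    and int: "set_integrable lborel {0<..<b} (\<lambda>x. (P b - P x) powr (- \<mu>) * W' x)"
  shows "(LINT x:{0<..<b}|lborel. (P b - P x) powr (- \<mu>) * W' x) \<le> 0"
proof -
  define f where "f x = (P b - P x) powr (- \<mu>) * W' x" for x
  have int_f: "set_integrable lborel {0<..<b} f" using int by (simp add: f_def[abs_def])
  have int_abs: "set_integrable lborel {0<..<b} (\<lambda>x. \<bar>f x\<bar>)"
    using set_integrable_abs[OF int_f] by simp
  have f: "f integrable_on {0..b}" and af: "(\<lambda>x. \<bar>f x\<bar>) integrable_on {0..b}"
    using set_borel_integral_eq_integral(1)[OF int_f] set_borel_integral_eq_integral(1)[OF int_abs]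
    by (simp_all add: integrable_on_Icc_iff_Ioo)
  have f_sub: "f integrable_on {x..y}" "(\<lambda>x. \<bar>f x\<bar>) integrable_on {x..y}" if "0 \<le> x" "y \<le> b" for x y
    using integrable_on_subinterval[OF f, of x y] integrable_on_subinterval[OF af, of x y] that by auto
  define I where "I x = integral {0..x} f" for x
  define J where "J x = integral {0..x} (\<lambda>x. \<bar>f x\<bar>)" for x
  have Idiff: "I y - I x = integral {x..y} f" and Jdiff: "J y - J x = integral {x..y} (\<lambda>x. \<bar>f x\<bar>)"
    if "0 \<le> x" "x \<le> y" "y \<le> b" for x y
    using Henstock_Kurzweil_Integration.integral_combine[of 0 x y f]
      Henstock_Kurzweil_Integration.integral_combine[of 0 x y "\<lambda>x. \<bar>f x\<bar>"] f_sub that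
    by (simp_all add: I_def J_def)
  have q_pos: "0 < P b - P x" if "x \<in> {0<..<b}" for x using P_less that by auto
  \<comment> \<open>Integration by parts on \<open>[e,a]\<close>, away from both end points. The
    term with the derivative of the weight is nonnegative, and so is the boundary term at
    \<open>e\<close>; both are dropped.\<close>
  have 1: "I a - I e \<le> (P b - P a) powr (- \<mu>) * W a" if "0 < e" "e < a" "a < b" for e a
  proof -
    let ?\<Phi> = "\<lambda>x. (P b - P x) powr (- \<mu>) * W x"
    let ?\<Phi>' = "\<lambda>x. \<mu> * (P b - P x) powr (- 1 - \<mu>) * p x * W x + f x"
    have "(f has_integral (I a - I e)) {e..a}"
      using f_sub[of e a] Idiff[of e a] that by (simp add: integrable_integral)
    moreover have "(?\<Phi>' has_integral (?\<Phi> a - ?\<Phi> e)) {e..a}"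
    proof (rule fundamental_theorem_of_calculus)
      fix x assume "x \<in> {e..a}"
      then have x: "x \<in> {0<..<b}" using that by auto
      then have "0 < x" "x < b" by auto
      from DERIV_mult[OF DERIV_powr_P_diff[OF this, of \<mu>] W_deriv[OF x]]
      have "(?\<Phi> has_real_derivative ?\<Phi>' x) (at x)"
        by (simp add: f_def mult_ac)
      then show "(?\<Phi> has_vector_derivative ?\<Phi>' x) (at x within {e..a})"
        using has_field_derivative_at_within has_real_derivative_iff_has_vector_derivative by blast
    qed (use that in auto)
    ultimately have "I a - I e \<le> ?\<Phi> a - ?\<Phi> e"
      by (rule has_integral_le)
         (use mu that in \<open>auto intro!: mult_nonneg_nonneg W_nonneg less_imp_le[OF p_pos]\<close>)
    moreover have "0 \<le> ?\<Phi> e" using W_nonneg[of e] that by auto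
    ultimately show ?thesis by simp
  qed
  \<comment> \<open>The weight increases with its argument, so its value at \<open>a\<close> may be
    moved under the integral of \<open>- W'\<close> over \<open>[a,c]\<close> and replaced by the
    larger weight at \<open>x\<close>. Then \<open>c\<close> tends to \<open>b\<close>, where
    \<open>W\<close> vanishes.\<close>
  have 2: "(P b - P a) powr (- \<mu>) * W a \<le> J b - J a" if a: "0 < a" "a < b" for a
  proof -
    have "(P b - P a) powr (- \<mu>) * (W a - W c) \<le> J b - J a" if c: "a < c" "c < b" for c
    proof -
      have "((\<lambda>x. (P b - P a) powr (- \<mu>) * W' x) has_integral
          ((P b - P a) powr (- \<mu>) * W c - (P b - P a) powr (- \<mu>) * W a)) {a..c}"
      proof (rule fundamental_theorem_of_calculus)
        fix x assume "x \<in> {a..c}"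
        then have "x \<in> {0<..<b}" using a c by auto
        from DERIV_cmult[OF W_deriv[OF this], of "(P b - P a) powr (- \<mu>)"]
        show "((\<lambda>x. (P b - P a) powr (- \<mu>) * W x) has_vector_derivative
            (P b - P a) powr (- \<mu>) * W' x) (at x within {a..c})"
          using has_field_derivative_at_within has_real_derivative_iff_has_vector_derivative by blast
      qed (use c in auto)
      from has_integral_neg[OF this]
      have "((\<lambda>x. - ((P b - P a) powr (- \<mu>) * W' x)) has_integral
          (P b - P a) powr (- \<mu>) * (W a - W c)) {a..c}" by (simp add: algebra_simps)
      moreover have "((\<lambda>x. \<bar>f x\<bar>) has_integral (J c - J a)) {a..c}"
        using f_sub[of a c] Jdiff[of a c] a c by (simp add: integrable_integral)
      ultimately have "(P b - P a) powr (- \<mu>) * (W a - W c) \<le> J c - J a"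
      proof (rule has_integral_le)
        fix x assume x: "x \<in> {a..c}"
        then have "0 < P b - P x" "P b - P x \<le> P b - P a"
          using q_pos[of x] P_le[of a x] a c by auto
        then have "(P b - P a) powr (- \<mu>) \<le> (P b - P x) powr (- \<mu>)"
          using mu by (intro powr_mono2') auto
        then have "(P b - P a) powr (- \<mu>) * \<bar>W' x\<bar> \<le> (P b - P x) powr (- \<mu>) * \<bar>W' x\<bar>"
          by (intro mult_right_mono) auto
        moreover have "- ((P b - P a) powr (- \<mu>) * W' x) \<le> (P b - P a) powr (- \<mu>) * \<bar>W' x\<bar>"
          using mult_left_mono[of "- W' x" "\<bar>W' x\<bar>" "(P b - P a) powr (- \<mu>)"] by simp
        ultimately show "- ((P b - P a) powr (- \<mu>) * W' x) \<le> \<bar>f x\<bar>"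
          by (simp add: f_def abs_mult)
      qed
      also have "J c - J a \<le> J b - J a"
      proof -
        have "0 \<le> J b - J c"
          using Jdiff[of c b] f_sub[of c b] a c by (simp add: integral_nonneg)
        then show ?thesis by simp
      qed
      finally show ?thesis .
    qed
    then have "\<forall>\<^sub>F c in at_left b. (P b - P a) powr (- \<mu>) * (W a - W c) \<le> J b - J a"
      using eventually_at_left_real[OF a(2)] by (auto elim!: eventually_mono)
    moreover have "((\<lambda>c. (P b - P a) powr (- \<mu>) * (W a - W c)) \<longlongrightarrow> (P b - P a) powr (- \<mu>) * (W a - 0)) (at_left b)"
      by (intro tendsto_intros W_lim)
    ultimately have "(P b - P a) powr (- \<mu>) * (W a - 0) \<le> J b - J a"
      by (intro tendsto_upperbound) auto
    then show ?thesis by simp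
  qed
  have I_cont: "continuous_on {0..b} I" and J_cont: "continuous_on {0..b} J"
    unfolding I_def J_def using f af by (auto intro: indefinite_integral_continuous_1)
  have I0: "(I \<longlongrightarrow> 0) (at_right 0)"
    using continuous_on_Icc_at_rightD[OF I_cont b_pos] by (simp add: I_def)
  \<comment> \<open>Combine the two estimates and let \<open>e\<close> tend to 0.\<close>
  have 3: "I a \<le> J b - J a" if a: "0 < a" "a < b" for a
  proof -
    have "\<forall>\<^sub>F e in at_right 0. I a - I e \<le> J b - J a"
      using eventually_at_right_real[OF a(1)]
    proof eventually_elim
      case (elim e)
      then show ?case using 1[of e a] 2[of a] a by auto
    qed
    moreover have "((\<lambda>e. I a - I e) \<longlongrightarrow> I a - 0) (at_right 0)"
      by (intro tendsto_intros I0)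
    ultimately have "I a - 0 \<le> J b - J a" by (intro tendsto_upperbound) auto
    then show ?thesis by simp
  qed
  have "I b \<le> J b - J b"
  proof (rule tendsto_le)
    show "(I \<longlongrightarrow> I b) (at_left b)" using continuous_on_Icc_at_leftD[OF I_cont b_pos] .
    show "((\<lambda>a. J b - J a) \<longlongrightarrow> J b - J b) (at_left b)"
      by (intro tendsto_intros continuous_on_Icc_at_leftD[OF J_cont b_pos])
    show "\<forall>\<^sub>F a in at_left b. I a \<le> J b - J a"
      using eventually_at_left_real[OF b_pos] by eventually_elim (use 3 in auto)
  qed auto
  moreover have "(LINT x:{0<..<b}|lborel. f x) = I b"
    using set_borel_integral_eq_integral(2)[OF int_f]
    by (simp add: I_def integral_open_interval_real[symmetric])
  ultimately show ?thesis by (simp add: f_def)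
qed

end

section \<open>The function \<open>W\<close> and its integral formula\<close>

text \<open>Here \<open>n\<close> stands for \<open>- m\<close> and \<open>\<beta>\<close> for the
  order of the inner fractional integral, which lies strictly between 0 and 1 exactly when the type
  is less than 1.\<close>

locale clock_weight = clock +
  fixes \<beta> :: real and n :: "real \<Rightarrow> real"
  assumes beta_pos: "0 < \<beta>" and beta_less_1: "\<beta> < 1"
    and n_meas [measurable]: "n \<in> borel_measurable borel"
    and n_nonneg: "\<And>x. 0 \<le> n x"
    and n_integrable: "\<And>s. s \<in> {0<..b} \<Longrightarrow>
          set_integrable lborel {0<..<s} (\<lambda>r. p r * (P s - P r) powr (\<beta> - 1) * n r)"
begin

definition k :: "real \<Rightarrow> real \<Rightarrow> real" where
  "k s r = p r * (P s - P r) powr (\<beta> - 1) * n r"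

definition G :: "real \<Rightarrow> real" where
  "G s = (LINT r:{0<..<s}|lborel. k s r)"

text \<open>Up to a boundary term at \<open>0\<close>, \<open>W a\<close> is \<open>\<integral>\<^sub>0\<^sup>a (P b - P s)\<^sup>-\<^sup>\<beta> G'(s) ds\<close> integrated by parts,
  a form that makes sense without differentiability of \<open>G\<close>.\<close>

definition W :: "real \<Rightarrow> real" where
  "W a = (P b - P a) powr (- \<beta>) * G a
     - \<beta> * (LINT s:{0<..<a}|lborel. p s * (P b - P s) powr (- 1 - \<beta>) * G s)"

lemma k_meas [measurable]: "case_prod k \<in> borel_measurable (borel \<Otimes>\<^sub>M borel)"
  unfolding k_def by measurable

lemma k_nonneg: "r \<in> {0..b} \<Longrightarrow> 0 \<le> k s r"
  using p_pos[of r] n_nonneg[of r] by (auto simp: k_def)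

lemma k_integrable: "s \<in> {0<..b} \<Longrightarrow> set_integrable lborel {0<..<s} (k s)"
  using n_integrable[of s] by (simp add: k_def[abs_def])

lemma G_nonneg: "s \<in> {0<..b} \<Longrightarrow> 0 \<le> G s"
  unfolding G_def set_lebesgue_integral_def
  by (intro integral_nonneg_AE AE_I2) (auto simp: indicator_def intro!: k_nonneg)

lemma nn_integral_k:
  assumes "s \<in> {0<..b}"
  shows "(\<integral>\<^sup>+ r. ennreal (indicator {0<..<s} r * k s r) \<partial>lborel) = ennreal (G s)"
  using k_integrable[OF assms] assms unfolding G_def set_lebesgue_integral_def set_integrable_def
  by (subst nn_integral_eq_integral) (auto simp: indicator_def intro!: k_nonneg)

lemma G_meas [measurable]: "G \<in> borel_measurable borel"
proof -
  \<comment> \<open>Moving the variable domain into a conditional makes the integrand jointly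
    measurable in \<open>s\<close> and \<open>r\<close>.\<close>
  have "G = (\<lambda>s. LINT r|lborel. (if 0 < r \<and> r < s then k s r else 0))"
    unfolding G_def set_lebesgue_integral_def
    by (intro ext Bochner_Integration.integral_cong) (auto simp: indicator_def)
  also have "\<dots> \<in> borel_measurable borel" by measurable
  finally show ?thesis .
qed

text \<open>Tonelli on the triangle \<open>0 < r < s < a\<close>, with
  \<open>kernel_convolution\<close> for the integral in \<open>s\<close>. With values in
  \<open>ennreal\<close> no integrability is required beforehand; it is deduced afterwards from the
  right side.\<close>

lemma nn_integral_G:
  assumes a: "0 < a" "a < b"
  shows "(\<integral>\<^sup>+ s. ennreal (indicator {0<..<a} s * (p s * (P b - P s) powr (- 1 - \<beta>) * G s)) \<partial>lborel)
    = (\<integral>\<^sup>+ r. ennreal (indicator {0<..<a} r * (p r * n r * ((P a - P r) powr \<beta> * (P b - P a) powr (- \<beta>)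
          / (\<beta> * (P b - P r))))) \<partial>lborel)"
proof -
  define w where "w s = p s * (P b - P s) powr (- 1 - \<beta>)" for s
  have w_nonneg: "0 \<le> w s" if "s \<in> {0..b}" for s using p_pos[OF that] by (simp add: w_def)
  have [measurable]: "w \<in> borel_measurable borel" unfolding w_def by measurable
  \<comment> \<open>The triangle is encoded in the integrand, so that both iterated integrals run
    over the whole line.\<close>
  define H where "H s r = ennreal (if s < a \<and> 0 < r \<and> r < s then w s * k s r else 0)" for s r
  have [measurable]: "case_prod H \<in> borel_measurable (lborel \<Otimes>\<^sub>M lborel)"
    unfolding H_def by measurable
  have "ennreal (indicator {0<..<a} s * (p s * (P b - P s) powr (- 1 - \<beta>) * G s))
      = (\<integral>\<^sup>+ r. H s r \<partial>lborel)" for s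
  proof (cases "0 < s \<and> s < a")
    case True
    then have "ennreal (indicator {0<..<a} s * (p s * (P b - P s) powr (- 1 - \<beta>) * G s))
        = ennreal (w s) * ennreal (G s)"
      using w_nonneg[of s] a by (simp add: w_def[symmetric] ennreal_mult')
    also have "\<dots> = (\<integral>\<^sup>+ r. ennreal (w s) * ennreal (indicator {0<..<s} r * k s r) \<partial>lborel)"
      using True a by (subst nn_integral_cmult) (auto simp: nn_integral_k)
    also have "\<dots> = (\<integral>\<^sup>+ r. H s r \<partial>lborel)"
      using True w_nonneg[of s] a
      by (intro nn_integral_cong) (auto simp: H_def indicator_def ennreal_mult'[symmetric])
    finally show ?thesis .
  next
    case False
    then have "H s r = 0" for r by (auto simp: H_def)
    with False show ?thesis by (auto simp: indicator_def)
  qed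
  then have "(\<integral>\<^sup>+ s. ennreal (indicator {0<..<a} s * (p s * (P b - P s) powr (- 1 - \<beta>) * G s)) \<partial>lborel)
      = (\<integral>\<^sup>+ s. (\<integral>\<^sup>+ r. H s r \<partial>lborel) \<partial>lborel)" by simp
  also have "\<dots> = (\<integral>\<^sup>+ r. (\<integral>\<^sup>+ s. H s r \<partial>lborel) \<partial>lborel)"
    by (rule lborel_pair.Fubini'[symmetric]) measurable
  also have "\<dots> = (\<integral>\<^sup>+ r. ennreal (indicator {0<..<a} r * (p r * n r * ((P a - P r) powr \<beta>
        * (P b - P a) powr (- \<beta>) / (\<beta> * (P b - P r))))) \<partial>lborel)"
  proof (rule nn_integral_cong)
    fix r
    show "(\<integral>\<^sup>+ s. H s r \<partial>lborel) = ennreal (indicator {0<..<a} r * (p r * n r * ((P a - P r) powr \<beta>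
        * (P b - P a) powr (- \<beta>) / (\<beta> * (P b - P r)))))"
    proof (cases "0 < r \<and> r < a")
      case True
      have pn: "0 \<le> p r * n r" using p_pos[of r] n_nonneg[of r] True a by auto
      have "(\<integral>\<^sup>+ s. H s r \<partial>lborel) = (\<integral>\<^sup>+ s. ennreal (p r * n r) * ennreal (indicator {r<..<a} s *
            (p s * (P b - P s) powr (- 1 - \<beta>) * (P s - P r) powr (\<beta> - 1))) \<partial>lborel)"
        using True pn
        by (intro nn_integral_cong) 
           (auto simp: H_def indicator_def ennreal_mult'[symmetric] w_def k_def mult_ac)
      also have "\<dots> = ennreal (p r * n r) * ennreal ((P a - P r) powr \<beta> * (P b - P a) powr (- \<beta>) / (\<beta> * (P b - P r)))"
        using True beta_pos a
        by (subst nn_integral_cmult) (auto simp: kernel_convolution)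
      finally show ?thesis using True pn by (simp add: ennreal_mult'[symmetric])
    next
      case False
      then have "H s r = 0" for s by (auto simp: H_def)
      with False show ?thesis by (auto simp: indicator_def)
    qed
  qed
  finally show ?thesis .
qed

lemma k_div_integrable:
  assumes a: "0 < a" "a < b"
  shows "set_integrable lborel {0<..<a} (\<lambda>r. k a r / (P b - P r))"
proof (rule set_integrable_bound[of lborel "{0<..<a}" "\<lambda>r. k a r / (P b - P a)"])
  show "set_integrable lborel {0<..<a} (\<lambda>r. k a r / (P b - P a))"
    using k_integrable[of a] a by simp
  show "set_borel_measurable lborel {0<..<a} (\<lambda>r. k a r / (P b - P r))"
    unfolding set_borel_measurable_def by measurable
  have "k a r / (P b - P r) \<le> k a r / (P b - P a)" if "0 < r" "r < a" for r
    using k_nonneg[of r a] P_less[of r a] P_less[of a b] a that by (intro divide_left_mono) auto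
  then show "AE r in lborel. r \<in> {0<..<a} \<longrightarrow> norm (k a r / (P b - P r)) \<le> norm (k a r / (P b - P a))"
    using a by (intro AE_I2) (auto simp: k_nonneg P_le abs_of_nonneg)
qed

text \<open>With \<open>q = P b - P a\<close>, writing \<open>P a - P r = (P b - P r) - q\<close>
  splits the kernel from \<open>nn_integral_G\<close> into two parts. The first integrates to a
  multiple of \<open>G a\<close> and cancels the boundary term of \<open>W a\<close>; what remains
  is an integral of \<open>n\<close> against a positive kernel.\<close>

lemma
  assumes a: "0 < a" "a < b"
  shows weighted_G_integrable:
          "set_integrable lborel {0<..<a} (\<lambda>s. p s * (P b - P s) powr (- 1 - \<beta>) * G s)"
    and W_eq: "W a = (P b - P a) powr (1 - \<beta>) * (LINT r:{0<..<a}|lborel. k a r / (P b - P r))"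
proof -
  define q where "q = P b - P a"
  have q: "0 < q" using P_less a by (simp add: q_def)
  define R where "R = (LINT r:{0<..<a}|lborel. k a r / (P b - P r))"
  let ?L = "\<lambda>r. q powr (- \<beta>) / \<beta> * (k a r - q * (k a r / (P b - P r)))"
  have L: "p r * n r * ((P a - P r) powr \<beta> * q powr (- \<beta>) / (\<beta> * (P b - P r))) = ?L r"
    if "0 < r" "r < a" for r
  proof -
    have 1: "P r < P a" "P r < P b" using P_less that a by auto
    have "(P a - P r) powr \<beta> = (P a - P r) powr (\<beta> - 1) * (P a - P r)"
      using 1 powr_add[of "P a - P r" "\<beta> - 1" 1] by simp
    then show ?thesis
      using 1 beta_pos by (simp add: k_def q_def divide_simps) (simp add: algebra_simps)
  qed
  have Lint: "set_integrable lborel {0<..<a} ?L"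
    using k_integrable[of a] k_div_integrable[OF a] a
    by (intro set_integrable_mult_right set_integral_diff(1) impI) auto
  have Lval: "(LINT r:{0<..<a}|lborel. ?L r) = q powr (- \<beta>) / \<beta> * (G a - q * R)"
  proof -
    have "set_integrable lborel {0<..<a} (\<lambda>r. q * (k a r / (P b - P r)))"
      using k_div_integrable[OF a] by (intro set_integrable_mult_right)
    with k_integrable[of a] a have "(LINT r:{0<..<a}|lborel. k a r - q * (k a r / (P b - P r)))
        = (LINT r:{0<..<a}|lborel. k a r) - (LINT r:{0<..<a}|lborel. q * (k a r / (P b - P r)))"
      by (intro set_integral_diff(2)) auto
    also have "\<dots> = G a - q * R"
      by (simp only: G_def R_def set_integral_mult_right)
    finally have "(LINT r:{0<..<a}|lborel. k a r - q * (k a r / (P b - P r))) = G a - q * R" .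
    then show ?thesis by (simp only: set_integral_mult_right)
  qed
  have Lpos: "0 \<le> ?L r" if "0 < r" "r < a" for r
    unfolding L[OF that, symmetric]
    using p_pos[of r] n_nonneg[of r] P_less[of r b] a that beta_pos by auto
  have LG: "(LINT r:{0<..<a}|lborel. ?L r) \<ge> 0"
    unfolding set_lebesgue_integral_def
    by (intro integral_nonneg_AE AE_I2) (use Lpos in \<open>auto simp: indicator_def\<close>)
  have "(\<integral>\<^sup>+ s. ennreal (indicator {0<..<a} s * (p s * (P b - P s) powr (- 1 - \<beta>) * G s)) \<partial>lborel)
      = (\<integral>\<^sup>+ r. ennreal (indicator {0<..<a} r *\<^sub>R ?L r) \<partial>lborel)"
    unfolding nn_integral_G[OF a]
  proof (rule nn_integral_cong)
    fix r
    have "indicator {0<..<a} r * (p r * n r * ((P a - P r) powr \<beta> * (P b - P a) powr (- \<beta>)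
          / (\<beta> * (P b - P r)))) = indicator {0<..<a} r *\<^sub>R ?L r"
      using L[of r] by (cases "0 < r \<and> r < a") (auto simp: q_def)
    then show "ennreal (indicator {0<..<a} r * (p r * n r * ((P a - P r) powr \<beta> * (P b - P a) powr (- \<beta>)
          / (\<beta> * (P b - P r))))) = ennreal (indicator {0<..<a} r *\<^sub>R ?L r)"
      by (simp only:)
  qed
  also have "\<dots> = ennreal (LINT r:{0<..<a}|lborel. ?L r)"
    unfolding set_lebesgue_integral_def
    by (intro nn_integral_eq_integral AE_I2)
       (use Lint Lpos in \<open>auto simp: indicator_def set_integrable_def\<close>)
  finally have nn: "(\<integral>\<^sup>+ s. ennreal (indicator {0<..<a} s * (p s * (P b - P s) powr (- 1 - \<beta>) * G s)) \<partial>lborel)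
      = ennreal (q powr (- \<beta>) / \<beta> * (G a - q * R))"
    by (simp only: Lval)
  have "0 \<le> p s * (P b - P s) powr (- 1 - \<beta>) * G s" if "0 < s" "s < a" for s
    using p_pos[of s] G_nonneg[of s] that a by auto
  \<comment> \<open>For a nonnegative measurable function a finite \<open>ennreal\<close> integral
    gives integrability and the value at once.\<close>
  then have "has_bochner_integral lborel
      (\<lambda>s. indicator {0<..<a} s * (p s * (P b - P s) powr (- 1 - \<beta>) * G s))
      (q powr (- \<beta>) / \<beta> * (G a - q * R))"
    using LG[unfolded Lval] nn
    by (intro has_bochner_integral_nn_integral AE_I2) (auto simp only: split: split_indicator, auto)
  then have 2: "set_integrable lborel {0<..<a} (\<lambda>s. p s * (P b - P s) powr (- 1 - \<beta>) * G s)"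
    and 3: "(LINT s:{0<..<a}|lborel. p s * (P b - P s) powr (- 1 - \<beta>) * G s)
        = q powr (- \<beta>) / \<beta> * (G a - q * R)"
    unfolding has_bochner_integral_iff set_integrable_def set_lebesgue_integral_def
    by simp_all
  show "set_integrable lborel {0<..<a} (\<lambda>s. p s * (P b - P s) powr (- 1 - \<beta>) * G s)" by (fact 2)
  have "q powr (1 - \<beta>) = q powr (- \<beta>) * q" using q powr_add[of q "- \<beta>" 1] by simp
  then show "W a = (P b - P a) powr (1 - \<beta>) * (LINT r:{0<..<a}|lborel. k a r / (P b - P r))"
    unfolding W_def 3 using beta_pos by (simp add: q_def[symmetric] R_def[symmetric] algebra_simps)
qed

lemma W_nonneg:
  assumes a: "0 < a" "a < b"
  shows "0 \<le> W a"
  unfolding W_eq[OF a] set_lebesgue_integral_def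
  using a P_le by (intro mult_nonneg_nonneg integral_nonneg_AE AE_I2)
    (auto simp: indicator_def intro!: k_nonneg divide_nonneg_nonneg)

section \<open>Vanishing of \<open>W\<close> at the end point\<close>

text \<open>Since \<open>\<beta> - 1\<close> is negative, the singular factor of
  \<open>k b r\<close> is bounded below by a positive constant, so integrability of
  \<open>k b\<close> carries over to \<open>p r * n r\<close>.\<close>

lemma pn_integrable: "set_integrable lborel {0<..<b} (\<lambda>r. p r * n r)"
proof (rule set_integrable_bound[of lborel "{0<..<b}" "\<lambda>r. (P b - P 0) powr (1 - \<beta>) * k b r"])
  show "set_integrable lborel {0<..<b} (\<lambda>r. (P b - P 0) powr (1 - \<beta>) * k b r)"
    using k_integrable[of b] b_pos by (intro set_integrable_mult_right) auto
  show "set_borel_measurable lborel {0<..<b} (\<lambda>r. p r * n r)"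
    unfolding set_borel_measurable_def by measurable
  have "norm (p r * n r) \<le> norm ((P b - P 0) powr (1 - \<beta>) * k b r)" if "0 < r" "r < b" for r
  proof -
    have q: "0 < P b - P r" "P b - P r \<le> P b - P 0" using P_less[of r b] P_le[of 0 r] that by auto
    have pn: "0 \<le> p r * n r" using p_pos[of r] n_nonneg[of r] that by simp
    have "1 = (P b - P r) powr (1 - \<beta>) * (P b - P r) powr (\<beta> - 1)"
      using q by (simp add: powr_add[symmetric])
    also have "\<dots> \<le> (P b - P 0) powr (1 - \<beta>) * (P b - P r) powr (\<beta> - 1)"
      using q beta_less_1 by (intro mult_right_mono powr_mono2) auto
    finally have "p r * n r * 1 \<le> p r * n r * ((P b - P 0) powr (1 - \<beta>) * (P b - P r) powr (\<beta> - 1))"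
      using pn by (intro mult_left_mono) auto
    also have "\<dots> = (P b - P 0) powr (1 - \<beta>) * k b r" by (simp add: k_def mult_ac)
    finally show ?thesis using pn by simp
  qed
  then show "AE r in lborel. r \<in> {0<..<b} \<longrightarrow> norm (p r * n r) \<le> norm ((P b - P 0) powr (1 - \<beta>) * k b r)"
    by (intro AE_I2) auto
qed

text \<open>The integral in \<open>W_eq\<close> is split at \<open>c\<close>. For
  \<open>r \<le> c\<close> the kernel is bounded by \<open>B\<close>, because \<open>d < a\<close>
  keeps \<open>a\<close> away from \<open>c\<close>, and the prefactor vanishes as \<open>a\<close>
  tends to \<open>b\<close>. For \<open>r > c\<close> one uses \<open>n r \<le> \<eta>\<close> and
  the uniform bound on the integral of the majorant.\<close>

lemma W_bound:
  assumes c: "0 < c" "c < d" "d < b" and eta: "0 \<le> \<eta>" "\<And>r. r \<in> {c<..<b} \<Longrightarrow> n r \<le> \<eta>"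
    and a: "d < a" "a < b"
  defines "B \<equiv> (P d - P c) powr (\<beta> - 1) / (P b - P c)"
  shows "W a \<le> (P b - P a) powr (1 - \<beta>) * B * (LINT r:{0<..<b}|lborel. p r * n r)
            + \<eta> * (1 / \<beta> + 1 / (1 - \<beta>))"
proof -
  define q where "q = P b - P a"
  have q: "0 < q" using P_less a c by (simp add: q_def)
  have B: "0 \<le> B" using P_le[of c b] c by (simp add: B_def)
  define M where "M = (LINT r:{0<..<b}|lborel. p r * n r)"
  define K where "K r = p r * ((P b - P a) * (P a - P r) powr (\<beta> - 1) * (P b - P r) powr (- 1 - \<beta>)
            + (P b - P a) powr (1 - \<beta>) * (P b - P r) powr (\<beta> - 2))" for r
  have [measurable]: "K \<in> borel_measurable borel" unfolding K_def by measurable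
  have K_nonneg: "0 \<le> K r" if "r \<in> {c<..<a}" for r
    using p_pos[of r] that a c q unfolding K_def q_def by (intro mult_nonneg_nonneg add_nonneg_nonneg) auto
  let ?F = "\<lambda>r. q powr (1 - \<beta>) * (k a r / (P b - P r))"
  have F_nonneg: "0 \<le> ?F r" if "0 < r" "r < a" for r
    using k_nonneg[of r a] P_le[of r b] that a c by auto
  have F_int: "set_integrable lborel {0<..<a} ?F"
    using k_div_integrable[of a] a c by (intro set_integrable_mult_right) auto
  have pn: "0 \<le> p r * n r" if "0 < r" "r < b" for r
    using p_pos[of r] n_nonneg[of r] that by simp
  have M_nonneg: "0 \<le> M"
    unfolding M_def set_lebesgue_integral_def
    by (intro integral_nonneg_AE AE_I2) (use pn in \<open>auto simp: indicator_def\<close>)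
  have W: "W a = (LINT r:{0<..<a}|lborel. ?F r)"
    using W_eq[of a] a c by (simp add: q_def del: times_divide_eq_right)
  have bound: "indicator {0<..<a} r *\<^sub>R ?F r \<le>
      q powr (1 - \<beta>) * B * (indicator {0<..<b} r * (p r * n r)) + \<eta> * (indicator {c<..<a} r * K r)"
    for r
  proof -
    consider "\<not> (0 < r \<and> r < a)" | "0 < r" "r \<le> c" | "c < r" "r < a" using c by linarith
    then show ?thesis
    proof cases
      case 1
      then have "r \<notin> {c<..<a}" using c by auto
      with 1 show ?thesis using pn[of r] B by (auto simp: indicator_def)
    next
      case 2
      have "k a r / (P b - P r) \<le> p r * n r * B"
      proof -
        have 3: "P d - P c \<le> P a - P r" "P b - P c \<le> P b - P r" "0 < P d - P c" "0 < P b - P c"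
          using P_le[of d a] P_le[of r c] P_less[of c d] P_less[of c b] 2 a c by auto
        then have "(P a - P r) powr (\<beta> - 1) / (P b - P r) \<le> B"
          unfolding B_def using beta_less_1 by (intro frac_le powr_mono2') auto
        then have "p r * n r * ((P a - P r) powr (\<beta> - 1) / (P b - P r)) \<le> p r * n r * B"
          using pn[of r] 2 a c by (intro mult_left_mono) auto
        then show ?thesis by (simp add: k_def mult_ac)
      qed
      then have "?F r \<le> q powr (1 - \<beta>) * (p r * n r * B)" by (intro mult_left_mono) auto
      then show ?thesis using 2 c a by (simp add: mult_ac)
    next
      case 3
      have Y: "0 < P a - P r" using P_less[of r a] 3 a c by auto
      have "?F r = n r * (p r * (q powr (1 - \<beta>) * (P a - P r) powr (\<beta> - 1) / (P b - P r)))"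
        by (simp add: k_def)
      also have "\<dots> \<le> n r * K r"
      proof (rule mult_left_mono[OF _ n_nonneg])
        \<comment> \<open>The majorant is applied with \<open>D = q\<close> and
          \<open>Y = P a - P r\<close>, whose sum is \<open>P b - P r\<close>.\<close>
        have "q powr (1 - \<beta>) * (P a - P r) powr (\<beta> - 1) / (P b - P r)
          \<le> q * (P a - P r) powr (\<beta> - 1) * (P b - P r) powr (- 1 - \<beta>) + q powr (1 - \<beta>) * (P b - P r) powr (\<beta> - 2)"
          using majorant_inequality[OF q Y beta_pos beta_less_1] by (simp add: q_def)
        then show "p r * (q powr (1 - \<beta>) * (P a - P r) powr (\<beta> - 1) / (P b - P r)) \<le> K r"
          unfolding K_def q_def[symmetric] using p_pos[of r] 3 a c by (intro mult_left_mono) auto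
      qed
      also have "\<dots> \<le> \<eta> * K r"
        using eta(2)[of r] K_nonneg[of r] 3 a c by (intro mult_right_mono) auto
      finally have "?F r \<le> \<eta> * K r" .
      moreover have "0 \<le> q powr (1 - \<beta>) * B * (p r * n r)" 
        using B pn[of r] 3 a c by (intro mult_nonneg_nonneg[OF mult_nonneg_nonneg]) auto
      ultimately show ?thesis using 3 c a by simp
    qed
  qed
  \<comment> \<open>Comparing \<open>ennreal\<close> integrals makes it possible to use the bound on
    the integral of \<open>K\<close> without first proving \<open>K\<close> integrable.\<close>
  have "ennreal (W a) = (\<integral>\<^sup>+ r. ennreal (indicator {0<..<a} r *\<^sub>R ?F r) \<partial>lborel)"
    unfolding W set_lebesgue_integral_def
    by (subst nn_integral_eq_integral)
       (use F_int F_nonneg in \<open>auto simp: set_integrable_def indicator_def\<close>)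
  also have "\<dots> \<le> (\<integral>\<^sup>+ r. ennreal (q powr (1 - \<beta>) * B) * ennreal (indicator {0<..<b} r * (p r * n r))
      + ennreal \<eta> * ennreal (indicator {c<..<a} r * K r) \<partial>lborel)"
  proof (rule nn_integral_mono)
    fix r
    have "0 \<le> indicator {0<..<b} r * (p r * n r)" using pn[of r] by (auto simp: indicator_def)
    moreover have "0 \<le> indicator {c<..<a} r * K r" using K_nonneg[of r] by (auto simp: indicator_def)
    ultimately show "ennreal (indicator {0<..<a} r *\<^sub>R ?F r) \<le>
        ennreal (q powr (1 - \<beta>) * B) * ennreal (indicator {0<..<b} r * (p r * n r))
      + ennreal \<eta> * ennreal (indicator {c<..<a} r * K r)"
      using ennreal_leI[OF bound[of r]] B eta(1) by (simp only: ennreal_plus ennreal_mult' mult_nonneg_nonneg powr_ge_zero)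
  qed
  also have "\<dots> = ennreal (q powr (1 - \<beta>) * B) * (\<integral>\<^sup>+ r. ennreal (indicator {0<..<b} r * (p r * n r)) \<partial>lborel)
      + ennreal \<eta> * (\<integral>\<^sup>+ r. ennreal (indicator {c<..<a} r * K r) \<partial>lborel)"
    by (subst nn_integral_add) (simp_all add: nn_integral_cmult)
  also have "(\<integral>\<^sup>+ r. ennreal (indicator {0<..<b} r * (p r * n r)) \<partial>lborel) = ennreal M"
    unfolding M_def set_lebesgue_integral_def
    by (subst nn_integral_eq_integral)
       (use pn_integrable pn in \<open>auto simp: set_integrable_def indicator_def\<close>)
  also have "ennreal \<eta> * (\<integral>\<^sup>+ r. ennreal (indicator {c<..<a} r * K r) \<partial>lborel)
      \<le> ennreal \<eta> * ennreal (1 / \<beta> + 1 / (1 - \<beta>))"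
    unfolding K_def using majorant_integral[of \<beta> c a] beta_pos beta_less_1 a c
    by (intro mult_left_mono) auto
  also have "ennreal (q powr (1 - \<beta>) * B) * ennreal M + ennreal \<eta> * ennreal (1 / \<beta> + 1 / (1 - \<beta>))
      = ennreal (q powr (1 - \<beta>) * B * M + \<eta> * (1 / \<beta> + 1 / (1 - \<beta>)))"
    using B M_nonneg eta(1) beta_pos beta_less_1 by (simp add: ennreal_plus ennreal_mult')
  finally have "ennreal (W a) \<le> ennreal (q powr (1 - \<beta>) * B * M + \<eta> * (1 / \<beta> + 1 / (1 - \<beta>)))"
    by (simp add: add_left_mono)
  moreover have "0 \<le> q powr (1 - \<beta>) * B * M + \<eta> * (1 / \<beta> + 1 / (1 - \<beta>))"
    using B M_nonneg eta(1) beta_pos beta_less_1 by (intro add_nonneg_nonneg mult_nonneg_nonneg) auto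
  ultimately show ?thesis by (simp add: q_def M_def)
qed

text \<open>The order of the choices matters: smallness of \<open>n\<close> near \<open>b\<close>
  fixes \<open>c\<close> and \<open>d\<close>, hence \<open>B\<close>; only then does
  \<open>a\<close> tend to \<open>b\<close>.\<close>

lemma W_tendsto_0:
  assumes n_lim: "(n \<longlongrightarrow> 0) (at_left b)"
  shows "(W \<longlongrightarrow> 0) (at_left b)"
proof (rule tendstoI)
  fix e :: real assume e: "0 < e"
  define C where "C = 1 / \<beta> + 1 / (1 - \<beta>)"
  have C: "0 < C" using beta_pos beta_less_1 by (simp add: C_def add_pos_pos)
  define \<eta> where "\<eta> = e / (2 * C)"
  have eta: "0 < \<eta>" "\<eta> * C = e / 2" using e C by (simp_all add: \<eta>_def)
  have "\<forall>\<^sub>F r in at_left b. n r < \<eta>"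
    using order_tendstoD(2)[OF n_lim eta(1)] .
  \<comment> \<open>The value of \<open>\<eta>\<close> makes the second term of
    \<open>W_bound\<close> equal to \<open>e / 2\<close>. Below, the maximum with
    \<open>b / 2\<close> keeps \<open>c\<close> positive, and \<open>d\<close> is the midpoint of
    \<open>c\<close> and \<open>b\<close>.\<close>
  then obtain c0 where c0: "c0 < b" "\<And>r. c0 < r \<Longrightarrow> r < b \<Longrightarrow> n r < \<eta>"
    unfolding eventually_at_left_field by blast
  define c where "c = max c0 (b / 2)"
  define d where "d = (c + b) / 2"
  have cd: "0 < c" "c < d" "d < b" using c0 b_pos by (auto simp: c_def d_def max_def field_simps)
  have nc: "n r \<le> \<eta>" if "r \<in> {c<..<b}" for r using c0(2)[of r] that by (auto simp: c_def)
  define B where "B = (P d - P c) powr (\<beta> - 1) / (P b - P c)"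
  define M where "M = (LINT r:{0<..<b}|lborel. p r * n r)"
  have "(P \<longlongrightarrow> P b) (at_left b)" using continuous_on_Icc_at_leftD[OF P_cont b_pos] .
  then have "((\<lambda>a. (P b - P a) powr (1 - \<beta>) * B * M) \<longlongrightarrow> (P b - P b) powr (1 - \<beta>) * B * M) (at_left b)"
  proof (intro tendsto_mult tendsto_powr' tendsto_diff tendsto_const)
    show "P b - P b \<noteq> 0 \<or> 0 < 1 - \<beta> \<and> (\<forall>\<^sub>F a in at_left b. 0 \<le> P b - P a)"
      using eventually_at_left_real[OF b_pos] beta_less_1
      by (intro disjI2 conjI) (auto elim!: eventually_mono intro: P_le)
  qed
  then have "\<forall>\<^sub>F a in at_left b. (P b - P a) powr (1 - \<beta>) * B * M < e / 2"
    using order_tendstoD(2)[of _ 0 "at_left b" "e / 2"] e by simp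
  then show "\<forall>\<^sub>F a in at_left b. dist (W a) 0 < e"
    using eventually_at_left_real[OF cd(3)]
  proof eventually_elim
    case (elim a)
    have "W a \<le> (P b - P a) powr (1 - \<beta>) * B * M + \<eta> * C"
      using W_bound[OF cd less_imp_le[OF eta(1)] nc, of a] elim by (simp add: B_def C_def M_def)
    moreover have "0 \<le> W a" using W_nonneg[of a] elim cd by auto
    ultimately show ?case using elim eta(2) by (simp add: dist_real_def)
  qed
qed

section \<open>Increments and derivative of \<open>W\<close>\<close>

text \<open>Taking differences replaces the integral from 0 by one over a closed interval inside
  \<open>(0,b)\<close>, to which the fundamental theorem of calculus applies.\<close>

lemma W_diff:
  assumes ea: "0 < e" "e \<le> a" "a < b"
  shows "(\<lambda>s. p s * (P b - P s) powr (- 1 - \<beta>) * G s) integrable_on {e..a}"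
    and "W a - W e = (P b - P a) powr (- \<beta>) * G a - (P b - P e) powr (- \<beta>) * G e
           - \<beta> * integral {e..a} (\<lambda>s. p s * (P b - P s) powr (- 1 - \<beta>) * G s)"
proof -
  define \<kappa> where "\<kappa> s = p s * (P b - P s) powr (- 1 - \<beta>) * G s" for s
  have i: "set_integrable lborel {0<..<x} \<kappa>" if "0 < x" "x < b" for x
    using weighted_G_integrable[OF that] by (simp add: \<kappa>_def[abs_def])
  have i2: "\<kappa> integrable_on {0..x}" if "0 < x" "x < b" for x
    using set_borel_integral_eq_integral(1)[OF i[OF that]] by (simp add: integrable_on_Icc_iff_Ioo)
  have W: "W x = (P b - P x) powr (- \<beta>) * G x - \<beta> * integral {0..x} \<kappa>" if "0 < x" "x < b" for x
    unfolding W_def \<kappa>_def[symmetric]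
    using set_borel_integral_eq_integral(2)[OF i[OF that]] by (simp add: integral_open_interval_real)
  have "\<kappa> integrable_on {e..a}"
    using integrable_on_subinterval[OF i2[of a], of e a] ea by auto
  then show "(\<lambda>s. p s * (P b - P s) powr (- 1 - \<beta>) * G s) integrable_on {e..a}"
    by (simp add: \<kappa>_def[abs_def])
  have "integral {0..e} \<kappa> + integral {e..a} \<kappa> = integral {0..a} \<kappa>"
    using ea i2[of a] by (intro Henstock_Kurzweil_Integration.integral_combine) auto
  then have "\<beta> * integral {0..e} \<kappa> + \<beta> * integral {e..a} \<kappa> = \<beta> * integral {0..a} \<kappa>"
    by (metis distrib_left)
  then show "W a - W e = (P b - P a) powr (- \<beta>) * G a - (P b - P e) powr (- \<beta>) * G e
           - \<beta> * integral {e..a} (\<lambda>s. p s * (P b - P s) powr (- 1 - \<beta>) * G s)"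
    unfolding \<kappa>_def[symmetric] using W[of a] W[of e] ea by simp
qed

lemma W_deriv:
  assumes G_deriv: "\<And>x. x \<in> {0<..<b} \<Longrightarrow> (G has_real_derivative G' x) (at x)"
    and x: "x \<in> {0<..<b}"
  shows "(W has_real_derivative (P b - P x) powr (- \<beta>) * G' x) (at x)"
proof -
  define \<kappa> where "\<kappa> s = p s * (P b - P s) powr (- 1 - \<beta>) * G s" for s
  define e where "e = x / 2"
  define c where "c = (x + b) / 2"
  have ec: "0 < e" "e < x" "x < c" "c < b" using x by (auto simp: e_def c_def)
  have q: "0 < P b - P x" using P_less x by auto
  have "isCont p x" using p_cont continuous_on_interior[of "{0..b}" p x] x by auto
  then have "isCont \<kappa> x"
    unfolding \<kappa>_def using q x
    by (intro continuous_intros P_isCont DERIV_isCont[OF G_deriv[OF x]]) auto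
  then have "((\<lambda>u. integral {e..u} \<kappa>) has_vector_derivative \<kappa> x) (at x within {e..c} - {})"
    using W_diff(1)[of e c] ec
    by (intro integral_has_vector_derivative_continuous_at)
       (auto simp: \<kappa>_def[abs_def] intro: continuous_at_imp_continuous_within)
  then have I: "((\<lambda>u. integral {e..u} \<kappa>) has_real_derivative \<kappa> x) (at x)"
    using ec by (simp add: has_real_derivative_iff_has_vector_derivative at_within_Icc_at)
  from x have "0 < x" "x < b" by auto
  from DERIV_mult[OF DERIV_powr_P_diff[OF this, of \<beta>] G_deriv[OF x]]
  have "((\<lambda>u. (P b - P u) powr (- \<beta>) * G u) has_real_derivative
      \<beta> * \<kappa> x + (P b - P x) powr (- \<beta>) * G' x) (at x)"
    by (simp add: \<kappa>_def mult_ac)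
  \<comment> \<open>The derivative of the weight contributes \<open>\<beta> * \<kappa> x\<close>,
    which the derivative of the subtracted integral cancels.\<close>
  from DERIV_diff[OF this DERIV_cmult[OF I, of \<beta>]]
  have "((\<lambda>u. W e - (P b - P e) powr (- \<beta>) * G e
      + ((P b - P u) powr (- \<beta>) * G u - \<beta> * integral {e..u} \<kappa>)) has_real_derivative
        0 + (\<beta> * \<kappa> x + (P b - P x) powr (- \<beta>) * G' x - \<beta> * \<kappa> x)) (at x)"
    by (intro DERIV_add DERIV_const)
  then have D: "((\<lambda>u. W e - (P b - P e) powr (- \<beta>) * G e
      + ((P b - P u) powr (- \<beta>) * G u - \<beta> * integral {e..u} \<kappa>)) has_real_derivative
        (P b - P x) powr (- \<beta>) * G' x) (at x)"
    by simp
  show ?thesis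
  proof (rule has_field_derivative_transform_within_open[OF D])
    show "open {e<..<c}" "x \<in> {e<..<c}" using ec by auto
    fix u assume "u \<in> {e<..<c}"
    then show "W e - (P b - P e) powr (- \<beta>) * G e
      + ((P b - P u) powr (- \<beta>) * G u - \<beta> * integral {e..u} \<kappa>) = W u"
      using W_diff(2)[of e u] ec unfolding \<kappa>_def by simp
  qed
qed

text \<open>Only the derivative of \<open>G\<close> at \<open>b\<close> is assumed, so
  \<open>W\<close> is compared through its increments. If \<open>D > 0\<close>, then
  \<open>G < G b\<close> on some \<open>[e,b)\<close>, and the increment of \<open>W\<close> from
  \<open>e\<close> to \<open>b\<close> is at least
  \<open>(P b - P e) powr (- \<beta>) * (G b - G e) > 0\<close>. As \<open>W\<close> tends to 0 at
  \<open>b\<close>, this makes \<open>W e\<close> negative.\<close>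

lemma endpoint_deriv_nonpos:
  assumes n_lim: "(n \<longlongrightarrow> 0) (at_left b)"
    and G_deriv: "(G has_real_derivative D) (at b within {0..b})"
  shows "D \<le> 0"
proof (rule ccontr)
  assume "\<not> D \<le> 0"
  then have D: "0 < D" by simp
  have at_b: "at b within {0..b} = at_left b" using b_pos by (rule at_within_Icc_at_left)
  have quot: "((\<lambda>x. (G x - G b) / (x - b)) \<longlongrightarrow> D) (at_left b)"
    using G_deriv unfolding has_field_derivative_iff at_b .
  have "\<forall>\<^sub>F x in at_left b. 0 < (G x - G b) / (x - b)"
    using order_tendstoD(1)[OF quot D] .
  then obtain d0 where d0: "d0 < b" "\<And>x. d0 < x \<Longrightarrow> x < b \<Longrightarrow> 0 < (G x - G b) / (x - b)"
    unfolding eventually_at_left_field by blast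
  define e where "e = (max d0 0 + b) / 2"
  have e: "0 < e" "d0 < e" "e < b" using d0(1) b_pos by (auto simp: e_def max_def field_simps)
  have G_less: "G x < G b" if "e \<le> x" "x < b" for x
    using d0(2)[of x] that e by (auto simp: zero_less_divide_iff)
  have qe: "0 < P b - P e" using P_less e by auto
  \<comment> \<open>In the integral of \<open>W_diff\<close> the factor \<open>G s\<close> is
    replaced by the larger constant \<open>G b\<close>, after which the integrand has the primitive
    \<open>?F\<close>.\<close>
  have step: "(P b - P e) powr (- \<beta>) * (G b - G e) - (P b - P a) powr (- \<beta>) * (G b - G a) \<le> W a - W e"
    if a: "e < a" "a < b" for a
  proof -
    let ?F = "\<lambda>s. G b * (P b - P s) powr (- \<beta>)"
    have "((\<lambda>s. \<beta> * (G b * (p s * (P b - P s) powr (- 1 - \<beta>)))) has_integral (?F a - ?F e)) {e..a}"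
    proof (rule fundamental_theorem_of_calculus)
      fix x assume "x \<in> {e..a}"
      then have x: "0 < x" "x < b" using a e by auto
      from DERIV_cmult[OF DERIV_powr_P_diff[OF x, of \<beta>], of "G b"]
      have "(?F has_real_derivative \<beta> * (G b * (p x * (P b - P x) powr (- 1 - \<beta>)))) (at x)"
        by (simp add: mult_ac)
      then show "(?F has_vector_derivative \<beta> * (G b * (p x * (P b - P x) powr (- 1 - \<beta>)))) (at x within {e..a})"
        using has_field_derivative_at_within has_real_derivative_iff_has_vector_derivative by blast
    qed (use a in auto)
    then have F: "((\<lambda>s. \<beta> * (G b * (p s * (P b - P s) powr (- 1 - \<beta>)))) has_integral (?F a - ?F e)) {e..a}" .
    have "((\<lambda>s. \<beta> * (p s * (P b - P s) powr (- 1 - \<beta>) * G s)) has_integral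
        \<beta> * integral {e..a} (\<lambda>s. p s * (P b - P s) powr (- 1 - \<beta>) * G s)) {e..a}"
      using W_diff(1)[of e a] a e by (intro has_integral_mult_right integrable_integral) auto
    from this F have "\<beta> * integral {e..a} (\<lambda>s. p s * (P b - P s) powr (- 1 - \<beta>) * G s) \<le> ?F a - ?F e"
    proof (rule has_integral_le)
      fix s assume s: "s \<in> {e..a}"
      then have "p s * (P b - P s) powr (- 1 - \<beta>) * G s \<le> p s * (P b - P s) powr (- 1 - \<beta>) * G b"
        using G_less[of s] p_pos[of s] a e by (intro mult_left_mono) auto
      then show "\<beta> * (p s * (P b - P s) powr (- 1 - \<beta>) * G s) \<le> \<beta> * (G b * (p s * (P b - P s) powr (- 1 - \<beta>)))"
        using beta_pos by (simp add: mult_ac)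
    qed
    then show ?thesis
      using W_diff(2)[of e a] a e by (simp add: algebra_simps)
  qed
  \<comment> \<open>The quotient of \<open>G b - G a\<close> and \<open>P b - P a\<close> converges
    to \<open>D / p b\<close>, so the product is a bounded factor times
    \<open>(P b - P a) powr (1 - \<beta>)\<close>, which tends to 0.\<close>
  have lim: "((\<lambda>a. (P b - P a) powr (- \<beta>) * (G b - G a)) \<longlongrightarrow> 0) (at_left b)"
  proof -
    have Pq: "((\<lambda>x. (P x - P b) / (x - b)) \<longlongrightarrow> p b) (at_left b)"
      using P_deriv[of b] b_pos unfolding has_field_derivative_iff at_b by simp
    have "(P \<longlongrightarrow> P b) (at_left b)" using continuous_on_Icc_at_leftD[OF P_cont b_pos] .
    then have "((\<lambda>a. (P b - P a) powr (1 - \<beta>)) \<longlongrightarrow> (P b - P b) powr (1 - \<beta>)) (at_left b)"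
    proof (intro tendsto_powr' tendsto_diff tendsto_const)
      show "P b - P b \<noteq> 0 \<or> 0 < 1 - \<beta> \<and> (\<forall>\<^sub>F a in at_left b. 0 \<le> P b - P a)"
        using eventually_at_left_real[OF b_pos] beta_less_1
        by (intro disjI2 conjI) (auto elim!: eventually_mono intro: P_le)
    qed
    then have "((\<lambda>a. (P b - P a) powr (1 - \<beta>) * (((G a - G b) / (a - b)) / ((P a - P b) / (a - b))))
        \<longlongrightarrow> 0 * (D / p b)) (at_left b)"
      using p_pos[of b] b_pos by (intro tendsto_mult tendsto_divide quot Pq) auto
    moreover have "\<forall>\<^sub>F a in at_left b. (P b - P a) powr (1 - \<beta>) * (((G a - G b) / (a - b)) / ((P a - P b) / (a - b)))
        = (P b - P a) powr (- \<beta>) * (G b - G a)"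
      using eventually_at_left_real[OF b_pos]
    proof eventually_elim
      case (elim a)
      then have q: "0 < P b - P a" using P_less by auto
      have "(P b - P a) powr (1 - \<beta>) = (P b - P a) powr (- \<beta>) * (P b - P a)"
        using q powr_add[of "P b - P a" "- \<beta>" 1] by simp
      moreover have "((G a - G b) / (a - b)) / ((P a - P b) / (a - b)) = (G b - G a) / (P b - P a)"
        using elim q by (simp add: divide_simps) (simp add: algebra_simps)
      ultimately show ?case using q by simp
    qed
    ultimately show ?thesis by (simp add: tendsto_cong)
  qed
  have "(P b - P e) powr (- \<beta>) * (G b - G e) - 0 \<le> 0 - W e"
  proof (rule tendsto_le)
    show "((\<lambda>a. (P b - P e) powr (- \<beta>) * (G b - G e) - (P b - P a) powr (- \<beta>) * (G b - G a))
        \<longlongrightarrow> (P b - P e) powr (- \<beta>) * (G b - G e) - 0) (at_left b)"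
      by (intro tendsto_intros lim)
    show "((\<lambda>a. W a - W e) \<longlongrightarrow> 0 - W e) (at_left b)"
      by (intro tendsto_intros W_tendsto_0 n_lim)
    show "\<forall>\<^sub>F a in at_left b. (P b - P e) powr (- \<beta>) * (G b - G e)
        - (P b - P a) powr (- \<beta>) * (G b - G a) \<le> W a - W e"
      using eventually_at_left_real[OF e(3)] by eventually_elim (use step in auto)
  qed auto
  moreover have "0 < (P b - P e) powr (- \<beta>) * (G b - G e)"
    using qe G_less[of e] e by (intro mult_pos_pos) auto
  ultimately show False using W_nonneg[of e] e by simp
qed

end

section \<open>Passage to the Hilfer derivative\<close>

lemma deriv_on_J_works:
  assumes "f differentiable (at t within {0..T})"
  shows "(f has_real_derivative deriv_on_J T f t) (at t within {0..T})"
  using assms unfolding deriv_on_J_def has_real_derivative_iff_has_vector_derivative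
  by (simp add: vector_derivative_works)

locale hilfer_setting =
  fixes T \<mu> \<nu> t1 :: real and \<Psi> m :: "real \<Rightarrow> real"
  assumes T_pos: "0 < T"
    and mu: "0 < \<mu>" "\<mu> < 1" and nu: "0 \<le> \<nu>" "\<nu> \<le> 1"
    and mono: "mono_on {0..T} \<Psi>" and C1: "C1_on_J T \<Psi>"
    and deriv_nz: "\<And>t. t \<in> {0..T} \<Longrightarrow> deriv_on_J T \<Psi> t \<noteq> 0"
    and weighted: "m \<in> weighted_C T \<Psi> ((1 - \<nu>) * (1 - \<mu>))"
    and t1: "t1 \<in> {0<..T}" and m_t1: "m t1 = 0" and m_nonpos: "\<And>t. t \<in> {0<..<t1} \<Longrightarrow> m t \<le> 0"
    and ex: "hilfer_deriv_exists T \<Psi> \<mu> \<nu> m t1"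
begin

text \<open>
  \<open>P\<close>, \<open>p\<close>, \<open>n\<close> modify \<open>\<Psi>\<close>, its derivative and \<open>- m\<close> outside \<open>J\<close> or \<open>(0,t1]\<close>, where nothing is known
  about the latter, to make them Borel measurable on the whole line.
\<close>

definition P :: "real \<Rightarrow> real" where "P x = \<Psi> (max 0 (min T x))"
definition p :: "real \<Rightarrow> real" where "p x = indicator {0..T} x *\<^sub>R deriv_on_J T \<Psi> x"
definition n :: "real \<Rightarrow> real" where "n x = indicator {0<..t1} x *\<^sub>R (- m x)"

abbreviation \<beta> :: real where "\<beta> \<equiv> (1 - \<nu>) * (1 - \<mu>)"
abbreviation F :: "real \<Rightarrow> real" where "F \<equiv> frac_integral T \<Psi> \<beta> m"

lemma P_eq: "x \<in> {0..T} \<Longrightarrow> P x = \<Psi> x" by (simp add: P_def)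
lemma p_eq: "x \<in> {0..T} \<Longrightarrow> p x = deriv_on_J T \<Psi> x" by (simp add: p_def)

lemma \<Psi>_deriv: "t \<in> {0..T} \<Longrightarrow> (\<Psi> has_real_derivative deriv_on_J T \<Psi> t) (at t within {0..T})"
  using C1 by (intro deriv_on_J_works) (simp add: C1_on_J_def)

lemma \<Psi>_cont: "continuous_on {0..T} \<Psi>"
  using \<Psi>_deriv DERIV_continuous_on by blast

text \<open>Difference quotients of a monotone function are nonnegative, hence so is their limit;
  being nonzero, it is positive.\<close>

lemma deriv_pos:
  assumes t: "t \<in> {0..T}"
  shows "0 < deriv_on_J T \<Psi> t"
proof -
  have "((\<lambda>y. (\<Psi> y - \<Psi> t) / (y - t)) \<longlongrightarrow> deriv_on_J T \<Psi> t) (at t within {0..T})"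
    using \<Psi>_deriv[OF t] by (simp add: has_field_derivative_iff)
  moreover have "\<forall>\<^sub>F y in at t within {0..T}. 0 \<le> (\<Psi> y - \<Psi> t) / (y - t)"
  proof (unfold eventually_at_filter, intro always_eventually allI impI)
    fix y assume "y \<noteq> t" and y: "y \<in> {0..T}"
    then show "0 \<le> (\<Psi> y - \<Psi> t) / (y - t)"
      using mono_onD[OF mono, of y t] mono_onD[OF mono, of t y] t
      by (cases "y < t") (auto simp: divide_nonpos_nonpos)
  qed
  moreover have "at t within {0..T} \<noteq> bot"
    using t T_pos by (simp add: trivial_limit_within)
  ultimately have "0 \<le> deriv_on_J T \<Psi> t" by (rule tendsto_lowerbound)
  with deriv_nz[OF t] show ?thesis by simp
qed

text \<open>The clock is stopped at \<open>t1\<close> instead of \<open>T\<close>, since the sign of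
  \<open>m\<close> is known only up to \<open>t1\<close>.\<close>

sublocale clock t1 P p
proof
  show "0 < t1" using t1 by simp
  show "(P has_real_derivative p x) (at x within {0..t1})" if "x \<in> {0..t1}" for x
  proof -
    have x: "x \<in> {0..T}" using that t1 by auto
    have "(\<Psi> has_real_derivative p x) (at x within {0..t1})"
      unfolding p_eq[OF x] by (rule DERIV_subset[OF \<Psi>_deriv[OF x]]) (use t1 in auto)
    then show ?thesis
      by (rule has_field_derivative_transform_within[OF _ zero_less_one that]) (use t1 P_eq in auto)
  qed
  show "0 < p x" if "x \<in> {0..t1}" for x using deriv_pos[of x] p_eq[of x] that t1 by auto
  have dc: "continuous_on {0..T} (deriv_on_J T \<Psi>)" using C1 by (simp add: C1_on_J_def)
  then have "continuous_on {0..t1} (deriv_on_J T \<Psi>)" by (rule continuous_on_subset) (use t1 in auto)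
  then show "continuous_on {0..t1} p" using t1 by (subst continuous_on_cong[OF refl p_eq]) auto
  show "p \<in> borel_measurable borel"
    unfolding p_def[abs_def] using dc by (intro borel_measurable_continuous_on_indicator) auto
  \<comment> \<open>Clamping the argument to \<open>J\<close> is continuous, so \<open>P\<close> is
    continuous on the whole line.\<close>
  have "continuous_on UNIV P"
    unfolding P_def by (rule continuous_on_compose2[OF \<Psi>_cont]) (use T_pos in \<open>auto intro!: continuous_intros\<close>)
  then show "P \<in> borel_measurable borel" by (rule borel_measurable_continuous_onI)
qed

text \<open>The weight is continuous and positive on \<open>(0,t1]\<close>, so dividing the
  continuous weighted function by it recovers \<open>m\<close> there.\<close>

lemma m_cont: "continuous_on {0<..t1} m"
proof -
  obtain g where g: "continuous_on {0..T} g"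
    "\<And>t. t \<in> {0<..T} \<Longrightarrow> g t = (\<Psi> t - \<Psi> 0) powr \<beta> * m t"
    using weighted by (auto simp: weighted_C_def)
  have pos: "0 < \<Psi> t - \<Psi> 0" if "t \<in> {0<..t1}" for t
    using P_less[of 0 t] P_eq[of t] P_eq[of 0] that t1 by auto
  have "continuous_on {0<..t1} (\<lambda>t. g t / (\<Psi> t - \<Psi> 0) powr \<beta>)"
  proof (intro continuous_on_divide continuous_on_powr continuous_on_diff continuous_on_const ballI)
    show "continuous_on {0<..t1} g" by (rule continuous_on_subset[OF g(1)]) (use t1 in auto)
    show "continuous_on {0<..t1} \<Psi>" by (rule continuous_on_subset[OF \<Psi>_cont]) (use t1 in auto)
  qed (use pos in force)+
  moreover have "g t / (\<Psi> t - \<Psi> 0) powr \<beta> = m t" if "t \<in> {0<..t1}" for t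
    using g(2)[of t] pos[OF that] that t1 by simp
  ultimately show ?thesis by (subst continuous_on_cong[OF refl, symmetric]) auto
qed

lemma m_lim: "(m \<longlongrightarrow> 0) (at_left t1)"
proof -
  have "continuous_on {t1 / 2..t1} m"
    by (rule continuous_on_subset[OF m_cont]) (use t1 in auto)
  from continuous_on_Icc_at_leftD[OF this] show ?thesis using t1 m_t1 by simp
qed

lemma n_lim: "(n \<longlongrightarrow> 0) (at_left t1)"
proof -
  have "\<forall>\<^sub>F x in at_left t1. - m x = n x"
    using eventually_at_left_real[OF b_pos] by eventually_elim (auto simp: n_def)
  with tendsto_minus[OF m_lim] show ?thesis by (simp add: tendsto_cong)
qed

lemma \<beta>_bounds: "0 \<le> \<beta>" "\<beta> < 1"
proof -
  have "\<beta> \<le> 1 * (1 - \<mu>)" using mu nu by (intro mult_right_mono) auto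
  also have "\<dots> < 1" using mu by simp
  finally show "\<beta> < 1" .
  show "0 \<le> \<beta>" using mu nu by auto
qed

lemma frac_integrand_eq:
  assumes "s \<in> {0<..t1}" "r \<in> {0<..<s}"
  shows "p r * (P s - P r) powr (\<beta> - 1) * n r = - frac_integrand T \<Psi> \<beta> m s r"
  using assms t1 P_eq[of s] P_eq[of r] p_eq[of r] by (auto simp: frac_integrand_def n_def)

lemma clock_weight:
  assumes "0 < \<beta>"
  shows "clock_weight t1 P p \<beta> n"
proof unfold_locales
  show "0 < \<beta>" "\<beta> < 1" using assms \<beta>_bounds by auto
  show "n \<in> borel_measurable borel"
    unfolding n_def[abs_def] using m_cont
    by (intro borel_measurable_continuous_on_indicator continuous_on_minus) auto
  show "0 \<le> n x" for x
    using m_nonpos[of x] m_t1 by (cases "x = t1") (auto simp: n_def indicator_def)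
  show "set_integrable lborel {0<..<s} (\<lambda>r. p r * (P s - P r) powr (\<beta> - 1) * n r)"
    if s: "s \<in> {0<..t1}" for s
  proof -
    have "set_integrable lborel {0<..<s} (frac_integrand T \<Psi> \<beta> m s)"
      using ex s t1 assms by (auto simp: hilfer_deriv_exists_def frac_integral_exists_def)
    then have "set_integrable lborel {0<..<s} (\<lambda>r. (- 1) * frac_integrand T \<Psi> \<beta> m s r)"
      by (intro set_integrable_mult_right)
    then show ?thesis
      by (rule set_integrable_cong[THEN iffD1, rotated -1]) (simp_all add: frac_integrand_eq[OF s])
  qed
qed

text \<open>The minus sign comes from \<open>n = - m\<close>. The point 0, where both sides vanish,
  is included so that the equality holds on all of \<open>[0,t1]\<close>, the set within which the
  derivative at \<open>t1\<close> is transferred.\<close>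

lemma F_eq:
  assumes "0 < \<beta>" "s \<in> {0..t1}"
  shows "clock_weight.G P p \<beta> n s = - Gamma \<beta> * F s"
proof (cases "s = 0")
  case True
  then show ?thesis using assms
    by (simp add: clock_weight.G_def[OF clock_weight] frac_integral_def set_lebesgue_integral_def)
next
  case False
  with assms have s: "s \<in> {0<..t1}" by auto
  have "clock_weight.G P p \<beta> n s = (LINT r:{0<..<s}|lborel. (- 1) * frac_integrand T \<Psi> \<beta> m s r)"
    unfolding clock_weight.G_def[OF clock_weight[OF assms(1)]] clock_weight.k_def[OF clock_weight[OF assms(1)]]
    by (rule set_lebesgue_integral_cong) (auto simp: frac_integrand_eq[OF s])
  also have "\<dots> = - (LINT r:{0<..<s}|lborel. frac_integrand T \<Psi> \<beta> m s r)"
    by (subst set_integral_mult_right) simp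
  finally have "clock_weight.G P p \<beta> n s = - (LINT r:{0<..<s}|lborel. frac_integrand T \<Psi> \<beta> m s r)" .
  moreover have "F s = 1 / Gamma \<beta> * (LINT r:{0<..<s}|lborel. frac_integrand T \<Psi> \<beta> m s r)"
    unfolding frac_integral_def using assms(1) by (intro if_not_P) (metis less_irrefl)
  moreover have "Gamma \<beta> \<noteq> 0" using Gamma_real_pos[OF assms(1)] by (metis less_irrefl)
  ultimately show ?thesis by simp
qed

section \<open>The sign of the derivative for each type\<close>

text \<open>The outer operator is the identity, so \<open>hilfer_deriv_exists\<close> gives
  differentiability of the inner integral at \<open>t1\<close> only. This is the situation of
  \<open>endpoint_deriv_nonpos\<close>.\<close>

lemma hilfer_deriv_nonneg_type_0:
  assumes "\<nu> = 0"
  shows "0 \<le> hilfer_deriv T \<Psi> \<mu> \<nu> m t1"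
proof -
  have \<beta>: "0 < \<beta>" using assms mu by simp
  interpret clock_weight t1 P p \<beta> n by (rule clock_weight[OF \<beta>])
  have Gamma: "0 < Gamma \<beta>" using \<beta> by (rule Gamma_real_pos)
  define D where "D = deriv_on_J T F t1"
  have "F differentiable (at t1 within {0..T})"
    using ex assms by (simp add: hilfer_deriv_exists_def)
  then have "(F has_real_derivative D) (at t1 within {0..T})"
    unfolding D_def by (rule deriv_on_J_works)
  then have "(F has_real_derivative D) (at t1 within {0..t1})"
    by (rule DERIV_subset) (use t1 in auto)
  from DERIV_cmult[OF this, of "- Gamma \<beta>"]
  have "(G has_real_derivative - Gamma \<beta> * D) (at t1 within {0..t1})"
    by (rule has_field_derivative_transform_within[OF _ zero_less_one]) (use b_pos F_eq[OF \<beta>] in auto)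
  then have "- Gamma \<beta> * D \<le> 0" using n_lim by (intro endpoint_deriv_nonpos)
  then have "0 \<le> D" using Gamma by (simp add: zero_le_mult_iff)
  moreover have "hilfer_deriv T \<Psi> \<mu> \<nu> m t1 = 1 / deriv_on_J T \<Psi> t1 * D"
    using assms by (simp add: hilfer_deriv_def frac_integral_def[of _ _ 0] psi_deriv_def D_def)
  ultimately show ?thesis using deriv_pos[of t1] t1 by simp
qed

text \<open>Shared by the cases \<open>0 < \<nu> < 1\<close>, with \<open>W\<close> from
  \<open>clock_weight\<close> and \<open>c = Gamma \<beta>\<close>, and \<open>\<nu> = 1\<close>,
  with \<open>W = - m\<close> and \<open>c = 1\<close>. The outer integrand is a negative multiple
  of the one in \<open>outer_integral_nonpos\<close>.\<close>

lemma hilfer_deriv_nonneg_aux: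
  assumes nu_pos: "0 < \<nu>" and c: "0 < c"
    and W_deriv: "\<And>s. s \<in> {0<..<t1} \<Longrightarrow>
      (W has_real_derivative - c * (P t1 - P s) powr (- \<beta>) * deriv_on_J T F s) (at s)"
    and W_nonneg: "\<And>s. s \<in> {0<..<t1} \<Longrightarrow> 0 \<le> W s"
    and W_lim: "(W \<longlongrightarrow> 0) (at_left t1)"
  shows "0 \<le> hilfer_deriv T \<Psi> \<mu> \<nu> m t1"
proof -
  define \<gamma> where "\<gamma> = \<nu> * (1 - \<mu>)"
  have gamma: "0 < \<gamma>" using nu_pos mu by (simp add: \<gamma>_def)
  let ?h = "frac_integrand T \<Psi> \<gamma> (psi_deriv T \<Psi> F) t1"
  let ?f = "\<lambda>s. (P t1 - P s) powr (- \<mu>) * (- c * (P t1 - P s) powr (- \<beta>) * deriv_on_J T F s)"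
  have eq: "?f s = - c * ?h s" if s: "s \<in> {0<..<t1}" for s
  proof -
    have sT: "s \<in> {0..T}" "t1 \<in> {0..T}" using s t1 by auto
    \<comment> \<open>This splitting of the exponent leaves one power for the derivative of
      \<open>W\<close> and the other as the outer weight; the derivative of \<open>\<Psi>\<close>
      cancels against the one in \<open>psi_deriv\<close>.\<close>
    have "\<gamma> - 1 = - \<mu> + - \<beta>" by (simp add: \<gamma>_def algebra_simps)
    then have "(P t1 - P s) powr (\<gamma> - 1) = (P t1 - P s) powr (- \<mu>) * (P t1 - P s) powr (- \<beta>)"
      by (simp only: powr_add)
    moreover have "deriv_on_J T \<Psi> s \<noteq> 0" using deriv_nz[OF sT(1)] .
    ultimately show ?thesis
      using P_eq[OF sT(1)] P_eq[OF sT(2)] by (simp add: frac_integrand_def psi_deriv_def)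
  qed
  have h: "set_integrable lborel {0<..<t1} ?h"
  proof -
    have "frac_integral_exists T \<Psi> \<gamma> (psi_deriv T \<Psi> F) t1"
      using ex unfolding hilfer_deriv_exists_def \<gamma>_def by blast
    then show ?thesis using gamma by (simp add: frac_integral_exists_def)
  qed
  then have "set_integrable lborel {0<..<t1} (\<lambda>s. - c * ?h s)" by (intro set_integrable_mult_right)
  then have "set_integrable lborel {0<..<t1} ?f"
    by (rule set_integrable_cong[THEN iffD1, rotated -1]) (simp_all only: eq)
  then have "(LINT s:{0<..<t1}|lborel. ?f s) \<le> 0"
    using mu W_deriv W_nonneg W_lim by (intro outer_integral_nonpos) auto
  also have "(LINT s:{0<..<t1}|lborel. ?f s) = (LINT s:{0<..<t1}|lborel. - c * ?h s)"
    by (rule set_lebesgue_integral_cong) (use eq in auto)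
  also have "\<dots> = - c * (LINT s:{0<..<t1}|lborel. ?h s)" by (rule set_integral_mult_right)
  finally have "0 \<le> (LINT s:{0<..<t1}|lborel. ?h s)" using c by (simp add: zero_le_mult_iff)
  then have "0 \<le> 1 / Gamma \<gamma> * (LINT s:{0<..<t1}|lborel. ?h s)"
    using Gamma_real_pos[OF gamma] by simp
  then show ?thesis
    using gamma unfolding hilfer_deriv_def \<gamma>_def[symmetric] frac_integral_def[of _ _ \<gamma>] by simp
qed

lemma F_deriv:
  assumes "0 < \<nu>" "s \<in> {0<..<t1}"
  shows "(F has_real_derivative deriv_on_J T F s) (at s)"
proof -
  have "F differentiable (at s within {0..T})"
    using ex assms mu by (simp add: hilfer_deriv_exists_def)
  from deriv_on_J_works[OF this] show ?thesis
    using assms t1 by (simp add: at_within_Icc_at)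
qed

lemma hilfer_deriv_nonneg: "0 \<le> hilfer_deriv T \<Psi> \<mu> \<nu> m t1"
proof -
  consider "\<nu> = 0" | "0 < \<nu>" "\<nu> < 1" | "\<nu> = 1" using nu by linarith
  then show ?thesis
  proof cases
    case 1
    then show ?thesis by (rule hilfer_deriv_nonneg_type_0)
  next
    case 2
    then have \<beta>: "0 < \<beta>" using mu by simp
    interpret clock_weight t1 P p \<beta> n by (rule clock_weight[OF \<beta>])
    have "(G has_real_derivative - Gamma \<beta> * deriv_on_J T F s) (at s)" if s: "s \<in> {0<..<t1}" for s
      by (rule has_field_derivative_transform_within_open[OF DERIV_cmult[OF F_deriv[OF 2(1) s], of "- Gamma \<beta>"], of "{0<..<t1}"])
         (use s F_eq[OF \<beta>] in auto)
    from W_deriv[OF this]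
    have "(W has_real_derivative - Gamma \<beta> * (P t1 - P s) powr (- \<beta>) * deriv_on_J T F s) (at s)"
      if "s \<in> {0<..<t1}" for s using that by (simp add: mult_ac)
    then show ?thesis
      using 2(1) Gamma_real_pos[OF \<beta>] W_nonneg W_tendsto_0[OF n_lim]
      by (intro hilfer_deriv_nonneg_aux[of "Gamma \<beta>" W]) auto
  next
    case 3
    then have F: "F = m" by (simp add: frac_integral_def fun_eq_iff)
    show ?thesis
    proof (rule hilfer_deriv_nonneg_aux[of 1 "\<lambda>s. - m s"])
      fix s assume s: "s \<in> {0<..<t1}"
      \<comment> \<open>Here \<open>\<beta> = 0\<close>, and \<open>powr\<close> with exponent 0 is
        1 only for a nonzero base, whence the strict inequality.\<close>
      then have "P s < P t1" using P_less by auto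
      then show "((\<lambda>s. - m s) has_real_derivative - 1 * (P t1 - P s) powr (- \<beta>) * deriv_on_J T F s) (at s)"
        using DERIV_minus[OF F_deriv[OF _ s]] 3 F by simp
      show "0 \<le> - m s" using m_nonpos[OF s] by simp
    qed (use 3 tendsto_minus[OF m_lim] in auto)
  qed
qed

end

theorem theorem4p1:
  fixes T \<mu> \<nu> \<xi> t1 :: real and \<Psi> m :: "real \<Rightarrow> real"
  assumes "T > 0"
    and "0 < \<mu>" and "\<mu> < 1" and "0 \<le> \<nu>" and "\<nu> \<le> 1"
    and "\<xi> = \<mu> + \<nu> * (1 - \<mu>)"
    and "mono_on {0..T} \<Psi>" and "C1_on_J T \<Psi>"
    and "\<forall>t\<in>{0..T}. deriv_on_J T \<Psi> t \<noteq> 0"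
    and "m \<in> weighted_C T \<Psi> (1 - \<xi>)"
    and "t1 \<in> {0<..T}" and "m t1 = 0" and "\<forall>t\<in>{0<..<t1}. m t \<le> 0"
    and "hilfer_deriv_exists T \<Psi> \<mu> \<nu> m t1"
  shows "hilfer_deriv T \<Psi> \<mu> \<nu> m t1 \<ge> 0"
proof -
  have "1 - \<xi> = (1 - \<nu>) * (1 - \<mu>)"
    using assms(6) by (simp add: algebra_simps)
  with assms interpret hilfer_setting T \<mu> \<nu> t1 \<Psi> m
    by unfold_locales auto
  show ?thesis by (rule hilfer_deriv_nonneg)
qed

end
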